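(* If the following algorithm reaches Step 3, it correctly determines whether or not $p$ is prime: if $q(2^kQ)=\infty$ then $p$ is prime, and if $q(2^kQ)\neq\infty$ then $p$ is composite.
   Context: Let $p=2^kq-1$ with $k\geq 2$ an integer and $q$ a prime. Fix $\lambda>1$ and assume $2^k\lambda\leq\sqrt{p}$ and $\lambda\sqrt{p}>(p^{1/4}+1)^2$. The algorithm is: Step 1: take $x\in\mathbb{Z}$ with Jacobi symbol $\left(\frac{x}{p}\right)=-1$ and find $y$ with $\left(\frac{x^3-y^2}{p}\right)=1$; let $m=(x^3-y^2)/x \bmod p$, so that $Q=(x,y)$ lies on the curve $E: y^2=x^3-mx$; all subsequent calculations are done in $E(\mathbb{Z}_p)$ (i.e. with coordinates modulo $p$, using the usual elliptic curve addition formulas). Step 2: if $2^kQ=\infty$, go back to Step 1 and take another $y$; if $2^kQ\neq\infty$, go to Step 3. Step 3: if $q(2^kQ)=\infty$, declare $p$ prime; otherwise declare $p$ composite. *)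

theory Defs
  imports "HOL-Analysis.Analysis" "HOL-Number_Theory.Number_Theory"
begin

definition Jacobi :: "int \<Rightarrow> int \<Rightarrow> int" where
  "Jacobi a n = (\<Prod>l\<in>#prime_factorization n. Legendre a l)"

text \<open>
  Points of the curve \<open>y\<^sup>2 = x\<^sup>3 + a x + b\<close> with coordinates modulo \<open>n\<close>, where \<open>n\<close> need not
  be prime. \<open>Undefined\<close> is not a point: it records that the addition formulas required dividing
  by an element that is not a unit modulo \<open>n\<close>, which cannot happen when \<open>n\<close> is prime. In
  particular \<open>Undefined \<noteq> Infinity\<close>.
\<close>

datatype point = Infinity | Affine int int | Undefined

text \<open>
  The affine chord-and-tangent formulas modulo \<open>n\<close>; the constant term \<open>b\<close> of the curve does not
  occur in them. If the abscissae agree modulo \<open>n\<close> but the ordinates are neither equal nor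
  opposite (possible only for composite \<open>n\<close>), the last case applies, and its denominator is not
  a unit.
\<close>

definition slope_point :: "int \<Rightarrow> int \<Rightarrow> int \<Rightarrow> int \<Rightarrow> int \<Rightarrow> int \<Rightarrow> point" where
  "slope_point n x1 y1 x2 num den =
     (if coprime den n then
        let s = num * modular_inverse n den;
            x3 = (s\<^sup>2 - x1 - x2) mod n
        in Affine x3 ((s * (x1 - x3) - y1) mod n)
      else Undefined)"

fun add_points :: "int \<Rightarrow> int \<Rightarrow> point \<Rightarrow> point \<Rightarrow> point" where
  "add_points n a Undefined Q = Undefined"
| "add_points n a P Undefined = Undefined"
| "add_points n a Infinity Q = Q"
| "add_points n a P Infinity = P"
| "add_points n a (Affine x1 y1) (Affine x2 y2) =
     (if [x1 = x2] (mod n) \<and> [y1 = - y2] (mod n) then Infinity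
      else if [x1 = x2] (mod n) \<and> [y1 = y2] (mod n)
        then slope_point n x1 y1 x2 (3 * x1\<^sup>2 + a) (2 * y1)
      else slope_point n x1 y1 x2 (y2 - y1) (x2 - x1))"

text \<open>
  \<open>is_multiple n a P i R\<close>: some sequence of additions computing \<open>i P\<close> from \<open>P\<close> modulo \<open>n\<close> (for
  instance repeated addition, or double-and-add) has the outcome \<open>R\<close>. No order of the additions
  is singled out; for composite \<open>n\<close> the order may influence whether the outcome is
  \<open>Undefined\<close>, so this is a relation rather than a function.
\<close>

inductive is_multiple :: "int \<Rightarrow> int \<Rightarrow> point \<Rightarrow> nat \<Rightarrow> point \<Rightarrow> bool"
  for n a :: int and P :: point where
  zero: "is_multiple n a P 0 Infinity"
| one: "is_multiple n a P 1 P"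
| add: "is_multiple n a P i R \<Longrightarrow> is_multiple n a P j S \<Longrightarrow>
          is_multiple n a P (i + j) (add_points n a R S)"

lemma is_multiple_exists: "\<exists>R. is_multiple n a P i R"
proof (induction i)
  case 0
  show ?case by (blast intro: is_multiple.zero)
next
  case (Suc i)
  then obtain R where "is_multiple n a P i R" by blast
  from is_multiple.add[OF this is_multiple.one] show ?case by auto
qed

definition curve_coeff :: "int \<Rightarrow> int \<Rightarrow> int \<Rightarrow> int" where
  "curve_coeff p x y = ((x ^ 3 - y\<^sup>2) * modular_inverse p x) mod p"

lemma curve_coeff_on_curve:
  assumes "coprime x p"
  shows "[y\<^sup>2 = x ^ 3 - curve_coeff p x y * x] (mod p)"
proof -
  have "[(x ^ 3 - y\<^sup>2) * (modular_inverse p x * x) = (x ^ 3 - y\<^sup>2) * 1] (mod p)"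
    using assms by (intro cong_mult cong_refl cong_modular_inverse2)
  moreover have "[curve_coeff p x y * x = (x ^ 3 - y\<^sup>2) * modular_inverse p x * x] (mod p)"
    unfolding curve_coeff_def by (simp add: cong_def mod_mult_left_eq)
  ultimately have "[curve_coeff p x y * x = x ^ 3 - y\<^sup>2] (mod p)"
    by (metis cong_trans mult.assoc mult.right_neutral)
  then have "[x ^ 3 - curve_coeff p x y * x = x ^ 3 - (x ^ 3 - y\<^sup>2)] (mod p)"
    by (intro cong_diff cong_refl)
  then show ?thesis by (simp add: cong_sym)
qed

end

(*
  Suppose p is composite and l is a prime factor of p with l^2 <= p. Reducing all points modulo l,
  the point 2^k Q becomes a point of prime order q of the group E(Z/l). By Hasse's bound
  q <= (sqrt l + 1)^2 <= (p^(1/4) + 1)^2 < lambda sqrt p, which contradicts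
  q > p / 2^k >= lambda sqrt p. If p is prime, then p = 3 mod 4, so x |-> -x shows that
  E(Z/p) has p + 1 = 2^k q points, and Lagrange's theorem gives q (2^k Q) = O.

  For the curves y^2 = x^3 - m x, Hasse's bound is elementary (Jacobsthal): the error term
  J(m) = sum_x ((x^3 - m x) / l) satisfies J(m r^2) = (r / l) J(m), and
  sum_m J(m)^2 <= 2 l (l - 1) by orthogonality of quadratic characters.

  Associativity of the group law: dividing the product of the lines used for (P1 + P2) + P3 by a
  vertical line gives a function x^2 - c y + d x + e that vanishes at P1, P2, P3 and
  -((P1 + P2) + P3). If no partial sum vanishes, the first three zeros determine c, d and e, so
  P1 + (P2 + P3) leads to the same function and to the same fourth zero. The degenerate cases
  follow from the cancellation law (P + Q) - Q = P.
*)

theory Submission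
  imports Defs
begin

section \<open>Congruences as integer linear combinations of congruences\<close>

text \<open>The cofactors \<open>c1\<close>, ... are a certificate: they reduce a congruence modulo
  \<open>l\<close> to a polynomial identity over the integers, which
  \<open>Groebner_Basis.algebra\<close> can check.\<close>

lemma cong_lincomb1:
  fixes l :: int
  assumes "[p1 = q1] (mod l)" and "v - w = c1 * (p1 - q1)"
  shows "[v = w] (mod l)"
  using assms by (simp add: cong_iff_dvd_diff)

lemma cong_lincomb2:
  fixes l :: int
  assumes "[p1 = q1] (mod l)" "[p2 = q2] (mod l)" and "v - w = c1 * (p1 - q1) + c2 * (p2 - q2)"
  shows "[v = w] (mod l)"
  using assms by (simp add: cong_iff_dvd_diff)

lemma cong_lincomb3:
  fixes l :: int
  assumes "[p1 = q1] (mod l)" "[p2 = q2] (mod l)" "[p3 = q3] (mod l)"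
    and "v - w = c1 * (p1 - q1) + c2 * (p2 - q2) + c3 * (p3 - q3)"
  shows "[v = w] (mod l)"
  using assms by (simp add: cong_iff_dvd_diff)

lemma cong_lincomb4:
  fixes l :: int
  assumes "[p1 = q1] (mod l)" "[p2 = q2] (mod l)" "[p3 = q3] (mod l)" "[p4 = q4] (mod l)"
    and "v - w = c1 * (p1 - q1) + c2 * (p2 - q2) + c3 * (p3 - q3) + c4 * (p4 - q4)"
  shows "[v = w] (mod l)"
  using assms by (simp add: cong_iff_dvd_diff)

section \<open>Quadratic character sums\<close>

locale odd_prime_mod =
  fixes l :: int
  assumes prime_l: "prime l" and l_gt_2: "l > 2"
begin

abbreviation cong_l :: "int \<Rightarrow> int \<Rightarrow> bool" (infix "\<equiv>\<^sub>l" 50) where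
  "x \<equiv>\<^sub>l y \<equiv> [x = y] (mod l)"

lemma mult_cong_0_cases: "x * y \<equiv>\<^sub>l 0 \<Longrightarrow> x \<equiv>\<^sub>l 0 \<or> y \<equiv>\<^sub>l 0"
  using prime_l by (simp add: cong_0_iff prime_dvd_mult_iff)

lemma two_neq_0: "\<not> 2 \<equiv>\<^sub>l 0"
  using l_gt_2 by (auto simp: cong_0_iff dest: zdvd_imp_le)

abbreviation chi :: "int \<Rightarrow> int" ("\<chi>") where
  "\<chi> c \<equiv> Legendre c l"

lemma Legendre_cong:
  assumes "[x = y] (mod l)"
  shows "\<chi> x = \<chi> y"
proof -
  have "[x = c] (mod l) \<longleftrightarrow> [y = c] (mod l)" "[c = x] (mod l) \<longleftrightarrow> [c = y] (mod l)" for c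
    using assms by (simp_all add: cong_def)
  then show ?thesis by (simp add: Legendre_def QuadRes_def)
qed

lemma Legendre_eq_0_iff: "\<chi> x = 0 \<longleftrightarrow> [x = 0] (mod l)"
  by (simp add: Legendre_def)

lemma Legendre_cases: "\<chi> x = 0 \<or> \<chi> x = 1 \<or> \<chi> x = -1"
  by (simp add: Legendre_def)

lemma Legendre_le_1: "\<chi> x \<le> 1"
  using Legendre_cases[of x] by auto

lemma cong_small:
  assumes "[x = y] (mod l)" "\<bar>x - y\<bar> < l"
  shows "x = y"
  using assms zdvd_imp_le[of l "\<bar>x - y\<bar>"] by (cases "x = y") (auto simp: cong_iff_dvd_diff)

lemma Legendre_euler: "[\<chi> x = x ^ ((nat l - 1) div 2)] (mod l)"
  using euler_criterion[of "nat l" x] prime_l l_gt_2 by simp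

text \<open>Euler's criterion makes both sides congruent. As their values lie in {-1, 0, 1}, they
  differ by at most 2 < \<open>l\<close>, so they are equal.\<close>

lemma Legendre_mult: "\<chi> (x * y) = \<chi> x * \<chi> y"
proof (cases "[x = 0] (mod l) \<or> [y = 0] (mod l)")
  case True
  then have "\<chi> (x * y) = 0" unfolding Legendre_eq_0_iff by (auto simp: cong_0_iff)
  moreover have "\<chi> x = 0 \<or> \<chi> y = 0" using True unfolding Legendre_eq_0_iff .
  ultimately show ?thesis by auto
next
  case False
  have "[\<chi> (x * y) = \<chi> x * \<chi> y] (mod l)"
    using cong_trans[OF Legendre_euler[of "x * y"]] cong_sym[OF cong_mult[OF Legendre_euler Legendre_euler]]
    by (simp add: power_mult_distrib)
  moreover have "\<bar>\<chi> (x * y) - \<chi> x * \<chi> y\<bar> \<le> 2"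
    using Legendre_cases[of x] Legendre_cases[of y] Legendre_cases[of "x * y"] by auto
  ultimately show ?thesis using cong_small l_gt_2 by simp
qed

lemma Legendre_square: "\<not> [x = 0] (mod l) \<Longrightarrow> \<chi> (x\<^sup>2) = 1"
  using Legendre_cases[of x] Legendre_eq_0_iff[of x] by (auto simp: power2_eq_square Legendre_mult)

lemma Legendre_cube: "\<chi> (x ^ 3) = \<chi> x"
  using Legendre_cases[of x] by (auto simp: power3_eq_cube Legendre_mult)

lemma Legendre_minus_1:
  assumes "l mod 4 = 3"
  shows "\<chi> (- 1) = - 1"
proof -
  have "odd ((n - 1) div 2)" if "n mod 4 = 3" for n :: nat
    using that by presburger
  then have "odd ((nat l - 1) div 2)"
    using assms l_gt_2 nat_mod_distrib[of l 4] by simp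
  then have "[\<chi> (- 1) = - 1] (mod l)"
    using Legendre_euler[of "- 1"] by simp
  then show ?thesis
    using cong_small[of "\<chi> (- 1)" "- 1"] Legendre_cases[of "- 1"] l_gt_2 by fastforce
qed

lemma sqrt_unique:
  assumes "[x\<^sup>2 = y\<^sup>2] (mod l)"
  shows "[x = y] (mod l) \<or> [x = - y] (mod l)"
proof -
  have "l dvd (x - y) * (x + y)"
    using assms by (simp add: cong_iff_dvd_diff power2_eq_square algebra_simps)
  then show ?thesis
    using prime_l by (auto simp: prime_dvd_mult_iff cong_iff_dvd_diff)
qed

text \<open>The bridge between counting solutions and character sums: zero has one root, a nonzero
  square two, a nonsquare none.\<close>

lemma card_sqrt_mod: "int (card {y \<in> {0..<l}. [y\<^sup>2 = c] (mod l)}) = 1 + \<chi> c"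
proof -
  let ?A = "{y \<in> {0..<l}. [y\<^sup>2 = c] (mod l)}"
  consider "[c = 0] (mod l)" | "\<not> [c = 0] (mod l)" "QuadRes l c" | "\<not> [c = 0] (mod l)" "\<not> QuadRes l c"
    by blast
  then show ?thesis
  proof cases
    case 1
    have "[y\<^sup>2 = c] (mod l) \<longleftrightarrow> y = 0" if "y \<in> {0..<l}" for y
    proof -
      have "[y\<^sup>2 = c] (mod l) \<longleftrightarrow> [y\<^sup>2 = 0] (mod l)" using 1 by (simp add: cong_def)
      also have "\<dots> \<longleftrightarrow> l dvd y" using prime_l by (simp add: cong_0_iff prime_dvd_power_iff)
      also have "\<dots> \<longleftrightarrow> y = 0" using that by (auto dest: zdvd_imp_le)
      finally show ?thesis .
    qed
    then have "?A = {y \<in> {0..<l}. y = 0}" by blast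
    also have "\<dots> = {0}" using l_gt_2 by auto
    finally have "?A = {0}" .
    then show ?thesis using 1 by (simp add: Legendre_def)
  next
    case 2
    then obtain z0 where z0: "[z0\<^sup>2 = c] (mod l)" by (auto simp: QuadRes_def)
    define z where "z = z0 mod l"
    have z: "[z\<^sup>2 = c] (mod l)" "z \<in> {0..<l}"
      using z0 l_gt_2 by (simp_all add: z_def cong_def power_mod)
    have "z \<noteq> 0" using z 2 by (auto simp: cong_sym_eq)
    have "(l - z)\<^sup>2 - c = l * (l - 2 * z) + (z\<^sup>2 - c)" by (simp add: power2_eq_square algebra_simps)
    moreover have "l dvd z\<^sup>2 - c" using z(1) by (simp add: cong_iff_dvd_diff)
    ultimately have lz: "[(l - z)\<^sup>2 = c] (mod l)"
      unfolding cong_iff_dvd_diff by (metis dvd_add dvd_triv_left)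
    have "y = z \<or> y = l - z" if "y \<in> {0..<l}" "[y\<^sup>2 = c] (mod l)" for y
    proof -
      have "[y = z] (mod l) \<or> [y = - z] (mod l)"
        using that(2) z(1) by (intro sqrt_unique) (metis cong_sym cong_trans)
      moreover have "[- z = l - z] (mod l)" by (simp add: cong_iff_dvd_diff)
      ultimately have *: "[y = z] (mod l) \<or> [y = l - z] (mod l)"
        using cong_trans[of y "- z" l "l - z"] by blast
      have bounds: "\<bar>y - z\<bar> < l" "\<bar>y - (l - z)\<bar> < l"
        using that(1) z(2) \<open>z \<noteq> 0\<close> by (simp_all add: abs_less_iff)
      from * show ?thesis
      proof
        assume "[y = z] (mod l)"
        from cong_small[OF this bounds(1)] show ?thesis ..
      next
        assume "[y = l - z] (mod l)"
        from cong_small[OF this bounds(2)] show ?thesis ..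
      qed
    qed
    then have "?A = {z, l - z}" using z lz \<open>z \<noteq> 0\<close> by auto
    moreover have "z \<noteq> l - z"
    proof
      assume "z = l - z"
      then have "even l" by presburger
      then show False using prime_odd_int[OF prime_l l_gt_2] by blast
    qed
    ultimately show ?thesis using 2 by (simp add: Legendre_def)
  next
    case 3
    then have "?A = {}" by (auto simp: QuadRes_def)
    then have "card ?A = 0" by (simp only: card.empty)
    then show ?thesis using 3 by (simp only: Legendre_def if_False of_nat_0)
  qed
qed

text \<open>An injective map of the finite set of residues into itself permutes it.\<close>

lemma sum_reindex_mod:
  assumes f: "\<And>x y. [x = y] (mod l) \<Longrightarrow> f x = f y"
    and inj: "\<And>x y. [g x = g y] (mod l) \<Longrightarrow> [x = y] (mod l)"
  shows "(\<Sum>x = 0..<l. f (g x)) = sum f {0..<l}"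
proof -
  have "inj_on (\<lambda>x. g x mod l) {0..<l}"
  proof (rule inj_onI)
    fix x y assume "x \<in> {0..<l}" "y \<in> {0..<l}" "g x mod l = g y mod l"
    then show "x = y" using inj[of x y] by (simp add: cong_def)
  qed
  moreover have "(\<lambda>x. g x mod l) ` {0..<l} \<subseteq> {0..<l}" using l_gt_2 by auto
  ultimately have "bij_betw (\<lambda>x. g x mod l) {0..<l} {0..<l}"
    by (simp add: bij_betw_def endo_inj_surj)
  then have "(\<Sum>x = 0..<l. f (g x mod l)) = sum f {0..<l}" by (rule sum.reindex_bij_betw)
  moreover have "f (g x mod l) = f (g x)" for x by (intro f) simp
  ultimately show ?thesis by simp
qed

lemma sum_reindex_mult:
  assumes f: "\<And>x y. [x = y] (mod l) \<Longrightarrow> f x = f y" and r: "\<not> [r = 0] (mod l)"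
  shows "(\<Sum>x = 0..<l. f (r * x)) = sum f {0..<l}"
proof (rule sum_reindex_mod[OF f])
  have "coprime r l" using r prime_l by (metis cong_0_iff coprime_commute prime_imp_coprime)
  then show "[x = y] (mod l)" if "[r * x = r * y] (mod l)" for x y
    using that by (simp add: cong_mult_lcancel)
qed

text \<open>The \<open>r\<close> are grouped by the residue \<open>c\<close> of their square;
  \<open>card_sqrt_mod\<close> gives the size of each group.\<close>

lemma sum_squares_mod:
  assumes f: "\<And>x y. [x = y] (mod l) \<Longrightarrow> f x = f y"
  shows "(\<Sum>r = 0..<l. f (r\<^sup>2)) = (\<Sum>c = 0..<l. (1 + \<chi> c) * f c)"
proof -
  have "(\<Sum>r = 0..<l. f (r\<^sup>2)) = (\<Sum>r = 0..<l. f (r\<^sup>2 mod l))"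
    by (intro sum.cong refl f) simp
  also have "\<dots> = (\<Sum>c = 0..<l. \<Sum>r \<in> {r \<in> {0..<l}. r\<^sup>2 mod l = c}. f (r\<^sup>2 mod l))"
    using l_gt_2 by (intro sum.group[symmetric]) auto
  also have "\<dots> = (\<Sum>c = 0..<l. (1 + \<chi> c) * f c)"
  proof (intro sum.cong refl)
    fix c assume c: "c \<in> {0..<l}"
    have eq: "{r \<in> {0..<l}. r\<^sup>2 mod l = c} = {r \<in> {0..<l}. [r\<^sup>2 = c] (mod l)}"
      using c by (auto simp: cong_def)
    have "(\<Sum>r \<in> {r \<in> {0..<l}. r\<^sup>2 mod l = c}. f (r\<^sup>2 mod l)) =
        (\<Sum>r \<in> {r \<in> {0..<l}. r\<^sup>2 mod l = c}. f c)"
      by (intro sum.cong) auto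
    then show "(\<Sum>r \<in> {r \<in> {0..<l}. r\<^sup>2 mod l = c}. f (r\<^sup>2 mod l)) = (1 + \<chi> c) * f c"
      unfolding eq using card_sqrt_mod[of c] by simp
  qed
  finally show ?thesis .
qed

lemma sum_Legendre: "sum \<chi> {0..<l} = 0"
  using sum_squares_mod[of "\<lambda>_. 1"] l_gt_2 by (simp add: sum.distrib)

text \<open>
  For nonzero \<open>d\<close> the sum does not depend on \<open>d\<close>, by the substitution \<open>x \<mapsto> d x\<close>; its
  value follows by summing over all \<open>d\<close>.
\<close>

lemma sum_Legendre_shift:
  assumes "\<not> [d = 0] (mod l)"
  shows "(\<Sum>x = 0..<l. \<chi> x * \<chi> (x + d)) = - 1"
proof -
  define A where "A d = (\<Sum>x = 0..<l. \<chi> x * \<chi> (x + d))" for d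
  have A: "A d = A 1" if "\<not> [d = 0] (mod l)" for d
  proof -
    have "A d = (\<Sum>x = 0..<l. \<chi> (d * x) * \<chi> (d * x + d))"
      unfolding A_def
      by (rule sum_reindex_mult[OF _ that, where f = "\<lambda>x. \<chi> x * \<chi> (x + d)", symmetric])
        (auto intro!: arg_cong2[where f = "(*)"] Legendre_cong cong_add)
    also have "\<dots> = (\<Sum>x = 0..<l. (\<chi> d)\<^sup>2 * (\<chi> x * \<chi> (x + 1)))"
      by (intro sum.cong refl)
        (simp add: Legendre_mult power2_eq_square flip: distrib_left[of d _ 1, simplified])
    also have "(\<chi> d)\<^sup>2 = 1"
      using that Legendre_cases[of d] Legendre_eq_0_iff[of d] by auto
    finally show ?thesis by (simp add: A_def)
  qed
  have sq: "\<chi> x * \<chi> x = (if x = 0 then 0 else 1)" if "x \<in> {0..<l}" for x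
  proof -
    have "[x = 0] (mod l) \<longleftrightarrow> x = 0" using that by (auto simp: cong_def)
    then show ?thesis using Legendre_cases[of x] Legendre_eq_0_iff[of x] by auto
  qed
  have ins: "{0..<l} = insert 0 {1..<l}" using l_gt_2 by auto
  have "A 0 = (\<Sum>x = 0..<l. if x = 0 then 0 else 1)"
    unfolding A_def by (intro sum.cong) (auto simp: sq)
  also have "\<dots> = l - 1"
    unfolding ins using l_gt_2 by simp
  finally have A0: "A 0 = l - 1" .
  have "(\<Sum>d = 0..<l. A d) = (\<Sum>x = 0..<l. \<chi> x * (\<Sum>d = 0..<l. \<chi> (x + d)))"
    unfolding A_def by (subst sum.swap) (simp add: sum_distrib_left)
  also have "\<dots> = (\<Sum>x = 0..<l. \<chi> x * sum \<chi> {0..<l})"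
    by (intro sum.cong refl arg_cong2[where f = "(*)"] sum_reindex_mod Legendre_cong)
      (auto simp: cong_add_lcancel)
  also have "\<dots> = 0" by (simp add: sum_Legendre)
  finally have "A 0 + (\<Sum>d = 1..<l. A d) = 0" unfolding ins by simp
  also have "(\<Sum>d = 1..<l. A d) = (\<Sum>d = 1..<l. A 1)"
    by (intro sum.cong refl A) (auto simp: cong_def)
  finally have "(l - 1) * (A 1 + 1) = 0" using A0 l_gt_2 by (simp add: algebra_simps)
  then have "A 1 = - 1" using l_gt_2 by simp
  then show ?thesis using A[OF assms] by (simp add: A_def)
qed

text \<open>The substitution \<open>m \<mapsto> u - m\<close> leads to
  \<open>sum_Legendre_shift\<close> with \<open>d = v - u\<close>, or to the sum of the squares of
  \<open>\<chi>\<close>, which is \<open>l - 1\<close>. This is the orthogonality relation behind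
  the second moment below.\<close>

lemma sum_Legendre_quadratic:
  "(\<Sum>m = 0..<l. \<chi> (u - m) * \<chi> (v - m)) = (if [u = v] (mod l) then l else 0) - 1"
proof -
  have "(\<Sum>m = 0..<l. \<chi> (u - m) * \<chi> (v - m)) = (\<Sum>m = 0..<l. \<chi> (u - (u - m)) * \<chi> (v - (u - m)))"
    by (rule sum_reindex_mod[where g = "\<lambda>m. u - m" and f = "\<lambda>m. \<chi> (u - m) * \<chi> (v - m)", symmetric])
      (auto intro!: arg_cong2[where f = "(*)"] Legendre_cong cong_diff
        simp: cong_iff_dvd_diff dvd_diff_commute)
  then have eq: "(\<Sum>m = 0..<l. \<chi> (u - m) * \<chi> (v - m)) = (\<Sum>m = 0..<l. \<chi> m * \<chi> (m + (v - u)))"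
    by (simp add: algebra_simps)
  show ?thesis
  proof (cases "[u = v] (mod l)")
    case False
    then have "\<not> [v - u = 0] (mod l)"
      by (simp add: cong_iff_dvd_diff dvd_diff_commute)
    then show ?thesis using eq sum_Legendre_shift False by simp
  next
    case True
    have ins: "{0..<l} = insert 0 {1..<l}" using l_gt_2 by auto
    have "\<chi> (m + (v - u)) = \<chi> m" for m
      using True by (intro Legendre_cong) (simp add: cong_iff_dvd_diff dvd_diff_commute)
    moreover have "\<chi> m * \<chi> m = 1" if "m \<in> {1..<l}" for m
    proof -
      have "\<not> [m = 0] (mod l)" using that by (auto simp: cong_def)
      then show ?thesis using Legendre_cases[of m] Legendre_eq_0_iff[of m] by auto
    qed
    moreover have "\<chi> 0 = 0" using Legendre_eq_0_iff by simp
    ultimately show ?thesis using True l_gt_2 eq by (simp add: ins)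
  qed
qed

section \<open>Jacobsthal sums and Hasse's bound for \<open>y^2 = x^3 - m x\<close>\<close>

text \<open>For \<open>m\<close> nonzero modulo \<open>l\<close> this is minus the trace of
  Frobenius: the curve \<open>y^2 = x^3 - m x\<close> has \<open>l + 1 + jacobsthal m\<close>
  points.\<close>

definition jacobsthal :: "int \<Rightarrow> int" where
  "jacobsthal m = (\<Sum>x = 0..<l. \<chi> (x ^ 3 - m * x))"

lemma jacobsthal_cong: "[m = m'] (mod l) \<Longrightarrow> jacobsthal m = jacobsthal m'"
  unfolding jacobsthal_def
  by (intro sum.cong refl Legendre_cong cong_diff cong_mult cong_refl)

text \<open>Replacing \<open>x\<close> by \<open>r x\<close> extracts the factor \<open>r^3\<close>,
  whose character is that of \<open>r\<close>. Geometrically, the curve is twisted by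
  \<open>r\<close>.\<close>

lemma jacobsthal_mult_square:
  assumes "\<not> [r = 0] (mod l)"
  shows "jacobsthal (m * r\<^sup>2) = \<chi> r * jacobsthal m"
proof -
  have "jacobsthal (m * r\<^sup>2) = (\<Sum>x = 0..<l. \<chi> ((r * x) ^ 3 - m * r\<^sup>2 * (r * x)))"
    unfolding jacobsthal_def
    by (rule sum_reindex_mult[OF _ assms, where f = "\<lambda>x. \<chi> (x ^ 3 - m * r\<^sup>2 * x)", symmetric])
      (intro Legendre_cong cong_diff cong_mult cong_refl cong_pow)
  also have "\<dots> = (\<Sum>x = 0..<l. \<chi> (r ^ 3 * (x ^ 3 - m * x)))"
    by (intro sum.cong refl arg_cong[where f = \<chi>]) Groebner_Basis.algebra
  also have "\<dots> = \<chi> r * jacobsthal m"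
    by (simp add: Legendre_mult Legendre_cube jacobsthal_def sum_distrib_left)
  finally show ?thesis .
qed

text \<open>With \<open>r = - 1\<close> the twist leaves \<open>m\<close> unchanged but reverses the
  sign of the sum.\<close>

lemma jacobsthal_eq_0:
  assumes "l mod 4 = 3"
  shows "jacobsthal m = 0"
proof -
  have "\<not> [- 1 = 0] (mod l)" using l_gt_2 by (simp add: cong_0_iff)
  from jacobsthal_mult_square[OF this, of m] show ?thesis
    using Legendre_minus_1[OF assms] by simp
qed

text \<open>After opening the square, the sum over \<open>m\<close> is taken first. By orthogonality
  it leaves \<open>l\<close> times the pairs with \<open>x^2\<close> congruent to
  \<open>y^2\<close>, weighted by characters; the remaining \<open>- 1\<close> contributes a product
  of two vanishing sums of \<open>\<chi>\<close>.\<close>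

lemma sum_jacobsthal_squares: "(\<Sum>m = 0..<l. (jacobsthal m)\<^sup>2) \<le> 2 * l * (l - 1)"
proof -
  have mult: "\<chi> (x ^ 3 - m * x) = \<chi> x * \<chi> (x\<^sup>2 - m)" for x m
    by (simp add: power2_eq_square power3_eq_cube algebra_simps flip: Legendre_mult)
  let ?d = "\<lambda>x y. if [x\<^sup>2 = y\<^sup>2] (mod l) then \<chi> x * \<chi> y else 0"
  have "(\<Sum>m = 0..<l. (jacobsthal m)\<^sup>2) =
      (\<Sum>m = 0..<l. \<Sum>x = 0..<l. \<Sum>y = 0..<l. \<chi> x * \<chi> y * (\<chi> (x\<^sup>2 - m) * \<chi> (y\<^sup>2 - m)))"
    unfolding jacobsthal_def mult power2_eq_square sum_product
    by (intro sum.cong refl) (simp add: mult_ac)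
  also have "\<dots> = (\<Sum>x = 0..<l. \<Sum>m = 0..<l. \<Sum>y = 0..<l. \<chi> x * \<chi> y * (\<chi> (x\<^sup>2 - m) * \<chi> (y\<^sup>2 - m)))"
    by (rule sum.swap)
  also have "\<dots> = (\<Sum>x = 0..<l. \<Sum>y = 0..<l. \<Sum>m = 0..<l. \<chi> x * \<chi> y * (\<chi> (x\<^sup>2 - m) * \<chi> (y\<^sup>2 - m)))"
    by (intro sum.cong refl sum.swap)
  also have "\<dots> = (\<Sum>x = 0..<l. \<Sum>y = 0..<l. l * ?d x y - \<chi> x * \<chi> y)"
    unfolding sum_distrib_left[symmetric] sum_Legendre_quadratic
    by (intro sum.cong refl) (auto simp: algebra_simps)
  also have "\<dots> = l * (\<Sum>x = 0..<l. \<Sum>y = 0..<l. ?d x y)"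
    by (simp add: sum_subtractf sum_Legendre flip: sum_distrib_left)
  also have "\<dots> \<le> l * (2 * (l - 1))"
  proof (rule mult_left_mono)
    \<comment> \<open>Dropping \<open>x = 0\<close>, where \<open>\<chi>\<close> vanishes, produces
      the factor \<open>l - 1\<close> that \<open>jacobsthal_bound\<close> cancels.\<close>
    have "(\<Sum>x = 0..<l. \<Sum>y = 0..<l. ?d x y) = (\<Sum>x = 1..<l. \<Sum>y = 0..<l. ?d x y)"
    proof (rule sum.mono_neutral_right)
      show "\<forall>x \<in> {0..<l} - {1..<l}. (\<Sum>y = 0..<l. ?d x y) = 0"
      proof
        fix x assume "x \<in> {0..<l} - {1..<l}"
        then have "x = 0" by auto
        then have "\<chi> x = 0" by (simp add: Legendre_eq_0_iff)
        then show "(\<Sum>y = 0..<l. ?d x y) = 0" by (intro sum.neutral) auto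
      qed
    qed auto
    \<comment> \<open>Only the two square roots of \<open>x^2\<close> contribute to the inner sum,
      each at most 1.\<close>
    also have "\<dots> \<le> (\<Sum>x = 1..<l. 2)"
    proof (rule sum_mono)
      fix x assume "x \<in> {1..<l}"
      then have "\<not> [x = 0] (mod l)" by (auto simp: cong_def)
      have "(\<Sum>y = 0..<l. ?d x y) \<le> (\<Sum>y = 0..<l. if [y\<^sup>2 = x\<^sup>2] (mod l) then 1 else 0)"
        using Legendre_le_1 by (intro sum_mono) (auto simp: cong_sym_eq simp flip: Legendre_mult)
      also have "\<dots> = 1 + \<chi> (x\<^sup>2)"
        using card_sqrt_mod[of "x\<^sup>2"] by (simp add: sum.If_cases Int_def)
      also have "\<dots> = 2" using Legendre_square \<open>\<not> [x = 0] (mod l)\<close> by simp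
      finally show "(\<Sum>y = 0..<l. ?d x y) \<le> 2" .
    qed
    also have "\<dots> = 2 * (l - 1)" using l_gt_2 by simp
    finally show "(\<Sum>x = 0..<l. \<Sum>y = 0..<l. ?d x y) \<le> 2 * (l - 1)" .
  qed (use l_gt_2 in simp)
  finally show ?thesis by (simp add: algebra_simps)
qed

text \<open>
  \<open>(jacobsthal m)\<^sup>2\<close> only depends on the quadratic class of \<open>m\<close>, so it is at most the average
  of the squares over that class.
\<close>

lemma jacobsthal_bound:
  assumes "\<not> [m = 0] (mod l)"
  shows "(jacobsthal m)\<^sup>2 \<le> 4 * l"
proof -
  let ?f = "\<lambda>c. (jacobsthal (m * c))\<^sup>2"
  have f: "?f c = ?f c'" if "[c = c'] (mod l)" for c c'
    using that by (intro arg_cong[where f = "\<lambda>x. x\<^sup>2"] jacobsthal_cong cong_mult cong_refl)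
  have "(l - 1) * (jacobsthal m)\<^sup>2 = (\<Sum>r = 1..<l. (jacobsthal m)\<^sup>2)"
    using l_gt_2 by simp
  also have "\<dots> = (\<Sum>r = 1..<l. ?f (r\<^sup>2))"
  proof (intro sum.cong refl)
    fix r assume "r \<in> {1..<l}"
    then have r: "\<not> [r = 0] (mod l)" by (auto simp: cong_def)
    then show "(jacobsthal m)\<^sup>2 = ?f (r\<^sup>2)"
      using Legendre_cases[of r] Legendre_eq_0_iff[of r] jacobsthal_mult_square[OF r, of m] by auto
  qed
  also have "\<dots> \<le> (\<Sum>r = 0..<l. ?f (r\<^sup>2))"
    by (rule sum_mono2) auto
  also have "\<dots> = (\<Sum>c = 0..<l. (1 + \<chi> c) * ?f c)"
    by (rule sum_squares_mod[of ?f, OF f])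
  \<comment> \<open>Once the weight is replaced by 2, the arguments \<open>m * c\<close> run through
    all residues and the second moment applies.\<close>
  also have "\<dots> \<le> (\<Sum>c = 0..<l. 2 * ?f c)"
    using Legendre_le_1 by (intro sum_mono mult_right_mono) auto
  also have "\<dots> = 2 * (\<Sum>c = 0..<l. (jacobsthal c)\<^sup>2)"
    unfolding sum_distrib_left[symmetric]
    using sum_reindex_mult[OF _ assms, of "\<lambda>c. (jacobsthal c)\<^sup>2"] jacobsthal_cong by simp
  also have "\<dots> \<le> (l - 1) * (4 * l)"
    using sum_jacobsthal_squares by (simp add: algebra_simps)
  finally show ?thesis using l_gt_2 by simp
qed

section \<open>The group law modulo a prime\<close>

text \<open>Reduced representatives make equality of points the same as congruence of
  coordinates.\<close>

definition pt :: "int \<Rightarrow> int \<Rightarrow> point" where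
  "pt x y = Affine (x mod l) (y mod l)"

lemma pt_eq_iff: "pt x y = pt x' y' \<longleftrightarrow> x \<equiv>\<^sub>l x' \<and> y \<equiv>\<^sub>l y'"
  by (simp add: pt_def cong_def)

lemma pt_neq_Infinity [simp]: "pt x y \<noteq> Infinity" "Infinity \<noteq> pt x y"
  by (simp_all add: pt_def)

text \<open>Any \<open>s\<close> solving the slope congruence may replace the quotient computed with
  the modular inverse. The primed coordinates allow unreduced representatives in the result.\<close>

lemma slope_point_eq:
  assumes "\<not> den \<equiv>\<^sub>l 0" "s * den \<equiv>\<^sub>l num" "x1 \<equiv>\<^sub>l x1'" "x2 \<equiv>\<^sub>l x2'" "y1 \<equiv>\<^sub>l y1'"
    "s\<^sup>2 \<equiv>\<^sub>l x1' + x2' + x3" "y3 \<equiv>\<^sub>l s * (x1' - x3) - y1'"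
  shows "slope_point l x1 y1 x2 num den = pt x3 y3"
proof -
  have cop: "coprime den l"
    using assms(1) prime_l by (metis cong_0_iff coprime_commute prime_imp_coprime)
  define r where "r = num * modular_inverse l den"
  have "r \<equiv>\<^sub>l s * den * modular_inverse l den"
    unfolding r_def using assms(2) by (intro cong_mult cong_refl) (rule cong_sym)
  also have "s * den * modular_inverse l den \<equiv>\<^sub>l s * 1"
    unfolding mult.assoc by (intro cong_mult cong_refl cong_modular_inverse1 cop)
  finally have r: "r \<equiv>\<^sub>l s" by simp
  define z where "z = (r\<^sup>2 - x1 - x2) mod l"
  have "r\<^sup>2 - x1 - x2 \<equiv>\<^sub>l x1' + x2' + x3 - x1' - x2'"
    using r assms by (intro cong_diff) (auto intro: cong_trans cong_pow)
  then have z: "z \<equiv>\<^sub>l x3" by (simp add: z_def)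
  have "r * (x1 - z) - y1 \<equiv>\<^sub>l s * (x1' - x3) - y1'"
    using r z assms by (intro cong_diff cong_mult)
  then have "r * (x1 - z) - y1 \<equiv>\<^sub>l y3" using assms(7) cong_sym cong_trans by blast
  moreover have "slope_point l x1 y1 x2 num den = Affine z ((r * (x1 - z) - y1) mod l)"
    using cop by (simp add: slope_point_def r_def z_def Let_def)
  moreover have "z = x3 mod l" using z by (simp add: z_def cong_def)
  ultimately show ?thesis by (simp add: pt_def cong_def)
qed

lemma add_opposite:
  assumes "x1 \<equiv>\<^sub>l x2" "y1 \<equiv>\<^sub>l - y2"
  shows "add_points l a (pt x1 y1) (pt x2 y2) = Infinity"
proof -
  have "y1 mod l \<equiv>\<^sub>l - (y2 mod l)"
    using assms(2) by (simp add: cong_def mod_minus_eq)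
  then show ?thesis using assms(1) by (simp add: pt_def)
qed

end

section \<open>Elliptic curves modulo \<open>l\<close> and the lines that meet them\<close>

locale elliptic_curve_mod =
  odd_prime_mod l for l :: int +
  fixes a b :: int
  assumes nonsingular: "\<not> l dvd 4 * a ^ 3 + 27 * b\<^sup>2"
begin

definition on_curve :: "int \<Rightarrow> int \<Rightarrow> bool" where
  "on_curve x y \<longleftrightarrow> y\<^sup>2 \<equiv>\<^sub>l x ^ 3 + a * x + b"

text \<open>
  The conditions compare the coefficients in
  \<open>X\<^sup>3 + a X + b - (s X + t)\<^sup>2 = (X - x1) (X - x2) (X - x3)\<close>. They are symmetric in the three
  intersection points and cover chords and tangents alike.
\<close>

definition line_cuts :: "int \<Rightarrow> int \<Rightarrow> int \<Rightarrow> int \<Rightarrow> int \<Rightarrow> bool" where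
  "line_cuts s t x1 x2 x3 \<longleftrightarrow> s\<^sup>2 \<equiv>\<^sub>l x1 + x2 + x3 \<and>
     a - 2 * s * t \<equiv>\<^sub>l x1 * x2 + x1 * x3 + x2 * x3 \<and> t\<^sup>2 - b \<equiv>\<^sub>l x1 * x2 * x3"

lemma line_cutsD:
  assumes "line_cuts s t x1 x2 x3"
  shows "s\<^sup>2 \<equiv>\<^sub>l x1 + x2 + x3" "a - 2 * s * t \<equiv>\<^sub>l x1 * x2 + x1 * x3 + x2 * x3"
    "t\<^sup>2 - b \<equiv>\<^sub>l x1 * x2 * x3"
  using assms by (auto simp: line_cuts_def)

lemma line_cuts_swap12: "line_cuts s t x1 x2 x3 \<Longrightarrow> line_cuts s t x2 x1 x3"
  by (simp add: line_cuts_def algebra_simps)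

lemma line_cuts_swap23: "line_cuts s t x1 x2 x3 \<Longrightarrow> line_cuts s t x1 x3 x2"
  by (simp add: line_cuts_def algebra_simps)

lemma line_cuts_neg: "line_cuts s t x1 x2 x3 \<Longrightarrow> line_cuts (- s) (- t) x1 x2 x3"
  by (simp add: line_cuts_def)

lemma line_cuts_factor:
  assumes "line_cuts s t x1 x2 x3"
  shows "x ^ 3 + a * x + b - (s * x + t)\<^sup>2 \<equiv>\<^sub>l (x - x1) * (x - x2) * (x - x3)"
  by (rule cong_lincomb3[OF line_cutsD[OF assms], where ?c1.0 = "- x\<^sup>2" and ?c2.0 = x and ?c3.0 = "-1"])
    Groebner_Basis.algebra

lemma line_cuts_on_curve1:
  assumes "line_cuts s t x1 x2 x3"
  shows "on_curve x1 (s * x1 + t)"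
  unfolding on_curve_def
  by (rule cong_lincomb1[OF line_cuts_factor[OF assms, of x1], where ?c1.0 = "-1"]) Groebner_Basis.algebra

lemma line_cuts_on_curve:
  assumes "line_cuts s t x1 x2 x3"
  shows "on_curve x1 (s * x1 + t)" "on_curve x2 (s * x2 + t)" "on_curve x3 (s * x3 + t)"
  by (rule line_cuts_on_curve1, use assms line_cuts_swap12 line_cuts_swap23 in blast)+

lemma on_curve_same_x:
  assumes "on_curve x y" "on_curve x' y'" "x \<equiv>\<^sub>l x'"
  shows "y \<equiv>\<^sub>l y' \<or> y \<equiv>\<^sub>l - y'"
proof -
  have "(y - y') * (y + y') \<equiv>\<^sub>l 0"
    by (rule cong_lincomb3[OF assms[unfolded on_curve_def], where ?c1.0 = 1 and ?c2.0 = "-1"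
        and ?c3.0 = "x\<^sup>2 + x * x' + x'\<^sup>2 + a"]) Groebner_Basis.algebra
  from mult_cong_0_cases[OF this] show ?thesis
    by (simp add: cong_iff_dvd_diff)
qed

lemma slope_exists:
  assumes "on_curve x1 y1" "on_curve x2 y2" "\<not> (x1 \<equiv>\<^sub>l x2 \<and> y1 \<equiv>\<^sub>l - y2)"
  obtains s t x3 where "y1 \<equiv>\<^sub>l s * x1 + t" "y2 \<equiv>\<^sub>l s * x2 + t" "line_cuts s t x1 x2 x3"
proof -
  \<comment> \<open>Both equations hold for the slope of a chord as well as for that of a tangent.\<close>
  have "\<exists>s. s * (x2 - x1) \<equiv>\<^sub>l y2 - y1 \<and> s * (y1 + y2) \<equiv>\<^sub>l x1\<^sup>2 + x1 * x2 + x2\<^sup>2 + a"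
  proof (cases "x1 \<equiv>\<^sub>l x2")
    case True
    then have y: "y1 \<equiv>\<^sub>l y2" using on_curve_same_x assms by blast
    have "\<not> l dvd y1 + y2"
      using assms(3) True by (simp add: cong_iff_dvd_diff)
    then have "coprime (y1 + y2) l"
      using prime_l by (simp add: prime_imp_coprime coprime_commute)
    then obtain i where i: "(y1 + y2) * i \<equiv>\<^sub>l 1" using cong_solve_coprime_int by blast
    have "i * (x1\<^sup>2 + x1 * x2 + x2\<^sup>2 + a) * (y1 + y2) \<equiv>\<^sub>l x1\<^sup>2 + x1 * x2 + x2\<^sup>2 + a"
      by (rule cong_lincomb1[OF i, where ?c1.0 = "x1\<^sup>2 + x1 * x2 + x2\<^sup>2 + a"]) Groebner_Basis.algebra
    moreover have "r * (x2 - x1) \<equiv>\<^sub>l y2 - y1" for r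
      by (rule cong_lincomb2[OF True y, where ?c1.0 = "- r" and ?c2.0 = 1]) Groebner_Basis.algebra
    ultimately show ?thesis by blast
  next
    case False
    then have nz: "\<not> x2 - x1 \<equiv>\<^sub>l 0" by (simp add: cong_iff_dvd_diff dvd_diff_commute)
    then have "coprime (x2 - x1) l"
      using prime_l by (simp add: cong_0_iff prime_imp_coprime coprime_commute)
    then obtain i where i: "(x2 - x1) * i \<equiv>\<^sub>l 1" using cong_solve_coprime_int by blast
    have s: "i * (y2 - y1) * (x2 - x1) \<equiv>\<^sub>l y2 - y1"
      by (rule cong_lincomb1[OF i, where ?c1.0 = "y2 - y1"]) Groebner_Basis.algebra
    define s where "s = i * (y2 - y1)"
    \<comment> \<open>Times the nonzero factor \<open>x2 - x1\<close>, both sides of the second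
      equation become \<open>y2^2 - y1^2\<close>, by the first equation and by the curve
      equation.\<close>
    have "(x2 - x1) * (s * (y1 + y2) - (x1\<^sup>2 + x1 * x2 + x2\<^sup>2 + a)) \<equiv>\<^sub>l 0"
      by (rule cong_lincomb3[OF s[folded s_def] assms(1,2)[unfolded on_curve_def],
          where ?c1.0 = "y1 + y2" and ?c2.0 = "-1" and ?c3.0 = 1]) Groebner_Basis.algebra
    then have "s * (y1 + y2) - (x1\<^sup>2 + x1 * x2 + x2\<^sup>2 + a) \<equiv>\<^sub>l 0"
      using mult_cong_0_cases nz by blast
    then show ?thesis using s[folded s_def] by (auto simp: cong_iff_dvd_diff)
  qed
  then obtain s where s: "s * (x2 - x1) \<equiv>\<^sub>l y2 - y1"
    "s * (y1 + y2) \<equiv>\<^sub>l x1\<^sup>2 + x1 * x2 + x2\<^sup>2 + a" by blast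
  \<comment> \<open>\<open>t\<close> puts the first point on the line; \<open>x3\<close> is forced
    because the three roots sum to \<open>s^2\<close>.\<close>
  define t x3 where "t = y1 - s * x1" and "x3 = s\<^sup>2 - x1 - x2"
  have y2: "y2 \<equiv>\<^sub>l s * x2 + t"
    by (rule cong_lincomb1[OF s(1), where ?c1.0 = "-1"]) (simp add: t_def algebra_simps)
  have e2: "a - 2 * s * t \<equiv>\<^sub>l x1 * x2 + x1 * x3 + x2 * x3"
    by (rule cong_lincomb2[OF s, where ?c1.0 = "- s" and ?c2.0 = "-1"])
      (unfold t_def x3_def, Groebner_Basis.algebra)
  have e3: "t\<^sup>2 - b \<equiv>\<^sub>l x1 * x2 * x3"
    by (rule cong_lincomb2[OF assms(1)[unfolded on_curve_def] e2, where ?c1.0 = 1 and ?c2.0 = x1])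
      (unfold t_def x3_def, Groebner_Basis.algebra)
  have "line_cuts s t x1 x2 x3"
    using e2 e3 by (simp add: line_cuts_def x3_def)
  moreover have "y1 \<equiv>\<^sub>l s * x1 + t" by (simp add: t_def)
  ultimately show ?thesis using y2 that by blast
qed

section \<open>Associativity through functions with four zeros\<close>

text \<open>
  If the lines \<open>y = s x + t\<close> and \<open>y = m x + k\<close> meet the curve above \<open>u\<close> in opposite points, then
  \<open>(y - s x - t) (y - m x - k)\<close> is, modulo the equation of the curve, divisible by \<open>x - u\<close>. The
  quotient is \<open>quad\<close> with the coefficients of \<open>quad_vanishes\<close>.
\<close>

definition quad :: "int \<Rightarrow> int \<Rightarrow> int \<Rightarrow> int \<Rightarrow> int \<Rightarrow> int" where
  "quad c d e x y = x\<^sup>2 - c * y + d * x + e"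

lemma quad_cong: "x \<equiv>\<^sub>l x' \<Longrightarrow> y \<equiv>\<^sub>l y' \<Longrightarrow> quad c d e x y \<equiv>\<^sub>l quad c d e x' y'"
  unfolding quad_def by (intro cong_add cong_diff cong_mult cong_pow cong_refl)

text \<open>Substituting \<open>y = m x + k\<close> turns \<open>quad\<close> into the monic
  quadratic whose roots are the two intersections other than \<open>u\<close>. The certificate never
  divides by \<open>x - u\<close>, so coinciding intersections are allowed.\<close>

lemma quad_vanishes:
  assumes "line_cuts m k u x w" "m * u + k \<equiv>\<^sub>l - (s * u + t)" "m * x + k \<equiv>\<^sub>l y"
  shows "quad (s + m) (s * m + u) (a + s * k + m * t + u * s * m + u\<^sup>2) x y \<equiv>\<^sub>l 0"
  by (rule cong_lincomb4[OF assms(2,3) line_cutsD(1,2)[OF assms(1)], where ?c1.0 = m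
      and ?c2.0 = "s + m" and ?c3.0 = "- (x + u)" and ?c4.0 = 1])
    (unfold quad_def, Groebner_Basis.algebra)

text \<open>The coefficients are symmetric in the two lines, so the other intersections with the
  first line are zeros too.\<close>

lemma quad_vanishes':
  assumes "line_cuts s t u x w" "m * u + k \<equiv>\<^sub>l - (s * u + t)" "s * x + t \<equiv>\<^sub>l y"
  shows "quad (s + m) (s * m + u) (a + s * k + m * t + u * s * m + u\<^sup>2) x y \<equiv>\<^sub>l 0"
  by (rule cong_lincomb4[OF assms(2,3) line_cutsD(1,2)[OF assms(1)], where ?c1.0 = s
      and ?c2.0 = "s + m" and ?c3.0 = "- (x + u)" and ?c4.0 = 1])
    (unfold quad_def, Groebner_Basis.algebra)

text \<open>
  With the coefficients for \<open>P1 + (P2 + P3)\<close>, substituting the line through \<open>P1\<close> and \<open>P2\<close> into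
  \<open>quad\<close> gives \<open>(x - x1) (x - x2)\<close>; the conclusion compares the coefficients of \<open>x\<close>. For
  \<open>P1 = P2\<close> this says that \<open>quad\<close> vanishes doubly.
\<close>

lemma quad_slope:
  assumes L: "line_cuts s t x1 x2 u" and L': "line_cuts s' t' x2 x3 u'"
    and M': "line_cuts m' k' x1 u' w'"
    and h2: "s * x2 + t \<equiv>\<^sub>l s' * x2 + t'" and h1: "s * x1 + t \<equiv>\<^sub>l m' * x1 + k'"
    and hu: "m' * u' + k' \<equiv>\<^sub>l - (s' * u' + t')"
    and nd: "x1 \<equiv>\<^sub>l x2 \<Longrightarrow> \<not> u' \<equiv>\<^sub>l x1"
  shows "s' * m' + u' \<equiv>\<^sub>l (s' + m') * s - (x1 + x2)"
proof (cases "x1 \<equiv>\<^sub>l x2")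
  case False
  let ?e = "a + s' * k' + m' * t' + u' * s' * m' + u'\<^sup>2"
  let ?f = "quad (s' + m') (s' * m' + u') ?e"
  have f1: "?f x1 (s * x1 + t) \<equiv>\<^sub>l 0"
    using quad_vanishes[OF line_cuts_swap12[OF M'] hu] h1 by (simp add: cong_sym)
  have f2: "?f x2 (s * x2 + t) \<equiv>\<^sub>l 0"
    using quad_vanishes'[OF line_cuts_swap12[OF line_cuts_swap23[OF L']] hu] h2 by (simp add: cong_sym)
  have "(x1 - x2) * (s' * m' + u' - ((s' + m') * s - (x1 + x2))) \<equiv>\<^sub>l 0"
    by (rule cong_lincomb2[OF f1 f2, where ?c1.0 = 1 and ?c2.0 = "-1"])
      (unfold quad_def, Groebner_Basis.algebra)
  from mult_cong_0_cases[OF this] False show ?thesis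
    by (auto simp: cong_iff_dvd_diff)
next
  case True
  with nd have nz: "\<not> u' - x1 \<equiv>\<^sub>l 0" "\<not> u' - x2 \<equiv>\<^sub>l 0"
    unfolding cong_diff_iff_cong_0 using cong_trans[OF _ cong_sym[OF True], of u'] by auto
  \<comment> \<open>\<open>A1\<close> and \<open>A2\<close> measure how far the two opposite points
    above \<open>u'\<close> lie from the line through \<open>P1\<close> and \<open>P2\<close>. Their
    product is \<open>(s * u' + t)^2\<close> minus the square of the ordinate, so by
    \<open>line_cuts_factor\<close> it contains the factors \<open>u' - x1\<close> and
    \<open>u' - x2\<close>, which are then cancelled.\<close>
  have A1: "s' * u' + t' - (s * u' + t) \<equiv>\<^sub>l (s' - s) * (u' - x2)"
    by (rule cong_lincomb1[OF h2, where ?c1.0 = "-1"]) Groebner_Basis.algebra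
  have A2: "- (s' * u' + t') - (s * u' + t) \<equiv>\<^sub>l (m' - s) * (u' - x1)"
    by (rule cong_lincomb2[OF hu h1, where ?c1.0 = "-1" and ?c2.0 = "-1"]) Groebner_Basis.algebra
  have "(u' - x1) * (u' - x2) * ((s' - s) * (m' - s) + (u' - u)) \<equiv>\<^sub>l 0"
    by (rule cong_lincomb3[OF cong_mult[OF A1 A2] line_cuts_factor[OF L, of u']
          line_cuts_on_curve(3)[OF L', unfolded on_curve_def],
          where ?c1.0 = "-1" and ?c2.0 = "-1" and ?c3.0 = "-1"]) Groebner_Basis.algebra
  then have *: "(s' - s) * (m' - s) + (u' - u) \<equiv>\<^sub>l 0"
    using mult_cong_0_cases nz by blast
  show ?thesis
    by (rule cong_lincomb2[OF * line_cutsD(1)[OF L], where ?c1.0 = 1 and ?c2.0 = "-1"])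
      Groebner_Basis.algebra
qed

text \<open>Unprimed data compute \<open>(P1 + P2) + P3\<close>, primed data
  \<open>P1 + (P2 + P3)\<close>. Each bracketing yields a \<open>quad\<close>; the proof shows
  \<open>c\<close>, \<open>d\<close>, \<open>e\<close> to agree with their primed counterparts and
  then compares the fourth zeros. \<open>P1 = P2\<close> is allowed, which the treatment of doubling
  needs.\<close>

lemma chord_assoc:
  assumes L: "line_cuts s t x1 x2 u" and M: "line_cuts m k u x3 w"
    and L': "line_cuts s' t' x2 x3 u'" and M': "line_cuts m' k' x1 u' w'"
    and y1: "y1 \<equiv>\<^sub>l s * x1 + t" "y1 \<equiv>\<^sub>l m' * x1 + k'"
    and y2: "y2 \<equiv>\<^sub>l s * x2 + t" "y2 \<equiv>\<^sub>l s' * x2 + t'"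
    and y3: "y3 \<equiv>\<^sub>l m * x3 + k" "y3 \<equiv>\<^sub>l s' * x3 + t'"
    and hu: "- (s * u + t) \<equiv>\<^sub>l m * u + k" and hu': "- (s' * u' + t') \<equiv>\<^sub>l m' * u' + k'"
    and x13: "\<not> x1 \<equiv>\<^sub>l x3" and x23: "\<not> x2 \<equiv>\<^sub>l x3"
    and n12: "\<not> (x1 \<equiv>\<^sub>l x2 \<and> y1 \<equiv>\<^sub>l - y2)"
    and nu: "\<not> (x3 \<equiv>\<^sub>l u \<and> y3 \<equiv>\<^sub>l s * u + t)"
    and nu': "\<not> (x1 \<equiv>\<^sub>l u' \<and> y1 \<equiv>\<^sub>l s' * u' + t')"
  shows "w \<equiv>\<^sub>l w' \<and> m * w + k \<equiv>\<^sub>l m' * w' + k'"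
proof -
  define c d e where "c = s + m" and "d = s * m + u" and
    "e = a + s * k + m * t + u * s * m + u\<^sup>2"
  define c' d' e' where "c' = s' + m'" and "d' = s' * m' + u'" and
    "e' = a + s' * k' + m' * t' + u' * s' * m' + u'\<^sup>2"
  have Lu: "line_cuts s t u x1 x2" and L'u: "line_cuts s' t' u' x2 x3"
    using L L' line_cuts_swap12 line_cuts_swap23 by blast+
  note f = quad_vanishes[OF _ cong_sym[OF hu], folded c_def d_def e_def]
    quad_vanishes'[OF _ cong_sym[OF hu], folded c_def d_def e_def]
  note f' = quad_vanishes[OF _ cong_sym[OF hu'], folded c'_def d'_def e'_def]
    quad_vanishes'[OF _ cong_sym[OF hu'], folded c'_def d'_def e'_def]
  have f1: "quad c d e x1 y1 \<equiv>\<^sub>l 0" using f(2)[OF Lu] y1 by (simp add: cong_sym)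
  have f3: "quad c d e x3 y3 \<equiv>\<^sub>l 0" using f(1)[OF M] y3 by (simp add: cong_sym)
  have fw: "quad c d e w (m * w + k) \<equiv>\<^sub>l 0" using f(1)[OF line_cuts_swap23[OF M]] by simp
  have f'1: "quad c' d' e' x1 y1 \<equiv>\<^sub>l 0"
    using f'(1)[OF line_cuts_swap12[OF M']] y1 by (simp add: cong_sym)
  have f'3: "quad c' d' e' x3 y3 \<equiv>\<^sub>l 0"
    using f'(2)[OF line_cuts_swap23[OF L'u]] y3 by (simp add: cong_sym)
  have f'w: "quad c' d' e' w' (m' * w' + k') \<equiv>\<^sub>l 0"
    using f'(1)[OF line_cuts_swap23[OF line_cuts_swap12[OF M']]] by simp
  have d: "d \<equiv>\<^sub>l c * s - (x1 + x2)"
    by (rule cong_lincomb1[OF line_cutsD(1)[OF L], where ?c1.0 = "-1"])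
      (unfold c_def d_def, Groebner_Basis.algebra)
  \<comment> \<open>If \<open>u'\<close> were \<open>x1\<close>, then \<open>P1\<close> would be
    opposite to \<open>P2 + P3\<close>, against \<open>nu'\<close>, or equal to it. In the latter
    case the line through \<open>P2\<close> and \<open>P3\<close> gives \<open>y1 + y2\<close>
    congruent to 0, against \<open>n12\<close>.\<close>
  have nd: "\<not> u' \<equiv>\<^sub>l x1" if x12: "x1 \<equiv>\<^sub>l x2"
  proof
    assume u': "u' \<equiv>\<^sub>l x1"
    have "on_curve x1 (m' * x1 + k')" using line_cuts_on_curve(1)[OF M'] .
    moreover have "on_curve u' (s' * u' + t')" using line_cuts_on_curve(3)[OF L'] .
    ultimately consider "m' * x1 + k' \<equiv>\<^sub>l s' * u' + t'" | "m' * x1 + k' \<equiv>\<^sub>l - (s' * u' + t')"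
      using on_curve_same_x[OF _ _ cong_sym[OF u']] by blast
    then show False
    proof cases
      case 1
      then show False using cong_trans[OF y1(2) 1] cong_sym[OF u'] nu' by blast
    next
      case 2
      have "y1 + y2 \<equiv>\<^sub>l 0"
        by (rule cong_lincomb4[OF cong_trans[OF y1(2) 2] y2(2) u' x12, where ?c1.0 = 1 and ?c2.0 = 1
              and ?c3.0 = "- s'" and ?c4.0 = "- s'"]) Groebner_Basis.algebra
      with n12 x12 show False by (simp add: cong_iff_dvd_diff)
    qed
  qed
  have d': "d' \<equiv>\<^sub>l c' * s - (x1 + x2)"
    unfolding d'_def c'_def
    by (rule quad_slope[OF L L' M' cong_trans[OF cong_sym[OF y2(1)] y2(2)]
          cong_trans[OF cong_sym[OF y1(1)] y1(2)] cong_sym[OF hu'] nd])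
  have dd: "d - d' \<equiv>\<^sub>l (c - c') * s"
    by (rule cong_lincomb2[OF d d', where ?c1.0 = 1 and ?c2.0 = "-1"]) Groebner_Basis.algebra
  \<comment> \<open>The difference of the two \<open>quad\<close> functions is affine linear and
    vanishes at \<open>P1\<close> and \<open>P3\<close>, while \<open>dd\<close> makes it parallel
    to the line through \<open>P1\<close> and \<open>P2\<close>. Hence either \<open>c\<close> and
    \<open>c'\<close> agree or \<open>P3\<close> lies on that line.\<close>
  have "(x1 - x3) * (d - d') - (c - c') * (y1 - y3) \<equiv>\<^sub>l 0"
    by (rule cong_lincomb4[OF f1 f3 f'1 f'3, where ?c1.0 = 1 and ?c2.0 = "-1" and ?c3.0 = "-1"
          and ?c4.0 = 1]) (unfold quad_def, Groebner_Basis.algebra)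
  then have "(c - c') * (s * (x1 - x3) - (y1 - y3)) \<equiv>\<^sub>l 0"
    by (rule cong_lincomb2[OF _ dd, where ?c1.0 = 1 and ?c2.0 = "- (x1 - x3)"])
      Groebner_Basis.algebra
  \<comment> \<open>If \<open>P3\<close> were on the line, it would be its third intersection,
    because its abscissa differs from \<open>x1\<close> and \<open>x2\<close>; this contradicts
    \<open>nu\<close>.\<close>
  moreover have "\<not> s * (x1 - x3) - (y1 - y3) \<equiv>\<^sub>l 0"
  proof
    assume *: "s * (x1 - x3) - (y1 - y3) \<equiv>\<^sub>l 0"
    have y3': "y3 \<equiv>\<^sub>l s * x3 + t"
      by (rule cong_lincomb2[OF * y1(1), where ?c1.0 = 1 and ?c2.0 = 1]) Groebner_Basis.algebra
    have y3'': "(s * x3 + t)\<^sup>2 \<equiv>\<^sub>l (s' * x3 + t')\<^sup>2"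
      by (rule cong_pow[OF cong_trans[OF cong_sym[OF y3'] y3(2)]])
    have "(x3 - x1) * ((x3 - x2) * (x3 - u)) \<equiv>\<^sub>l 0"
      by (rule cong_lincomb3[OF line_cuts_factor[OF L, of x3] y3''
            line_cuts_on_curve(2)[OF L', unfolded on_curve_def],
            where ?c1.0 = "-1" and ?c2.0 = "-1" and ?c3.0 = "-1"]) Groebner_Basis.algebra
    from mult_cong_0_cases[OF this] mult_cong_0_cases[of "x3 - x2" "x3 - u"] have xu: "x3 \<equiv>\<^sub>l u"
      unfolding cong_diff_iff_cong_0 using x13 x23 cong_sym by blast
    have "y3 \<equiv>\<^sub>l s * u + t"
      by (rule cong_lincomb2[OF y3' xu, where ?c1.0 = 1 and ?c2.0 = s]) Groebner_Basis.algebra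
    with xu show False using nu by blast
  qed
  ultimately have c: "c - c' \<equiv>\<^sub>l 0" using mult_cong_0_cases by blast
  then have d0: "d - d' \<equiv>\<^sub>l 0"
    by (rule cong_lincomb2[OF _ dd, where ?c1.0 = s and ?c2.0 = 1]) Groebner_Basis.algebra
  have e: "e - e' \<equiv>\<^sub>l 0"
    by (rule cong_lincomb4[OF f1 f'1 c d0, where ?c1.0 = 1 and ?c2.0 = "-1" and ?c3.0 = y1
          and ?c4.0 = "- x1"]) (unfold quad_def, Groebner_Basis.algebra)
  \<comment> \<open>Eliminating \<open>y\<close> from \<open>quad\<close> and the curve gives a
    quartic in \<open>x\<close> with root sum \<open>c^2 - 2 d\<close>; this determines the fourth
    abscissa.\<close>
  have w: "w \<equiv>\<^sub>l c\<^sup>2 - 2 * d - x1 - x2 - x3"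
    by (rule cong_lincomb2[OF line_cutsD(1)[OF L] line_cutsD(1)[OF M], where ?c1.0 = "-1"
          and ?c2.0 = "-1"]) (unfold c_def d_def, Groebner_Basis.algebra)
  have w': "w' \<equiv>\<^sub>l c'\<^sup>2 - 2 * d' - x1 - x2 - x3"
    by (rule cong_lincomb2[OF line_cutsD(1)[OF L'] line_cutsD(1)[OF M'], where ?c1.0 = "-1"
          and ?c2.0 = "-1"]) (unfold c'_def d'_def, Groebner_Basis.algebra)
  have ww: "w \<equiv>\<^sub>l w'"
    by (rule cong_lincomb4[OF w w' c d0, where ?c1.0 = 1 and ?c2.0 = "-1" and ?c3.0 = "c + c'"
          and ?c4.0 = "-2"]) Groebner_Basis.algebra
  \<comment> \<open>Above the common abscissa both ordinates solve the same equation, which is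
    linear in \<open>y\<close> with coefficient \<open>c\<close>.\<close>
  have "quad c' d' e' w (m' * w' + k') \<equiv>\<^sub>l 0"
    by (rule cong_trans[OF quad_cong[OF ww cong_refl] f'w])
  then have "quad c d e w (m' * w' + k') \<equiv>\<^sub>l 0"
    by (rule cong_lincomb4[OF _ c d0 e, where ?c1.0 = 1 and ?c2.0 = "- (m' * w' + k')" and ?c3.0 = w
          and ?c4.0 = 1]) (unfold quad_def, Groebner_Basis.algebra)
  then have "c * (m * w + k - (m' * w' + k')) \<equiv>\<^sub>l 0"
    by (rule cong_lincomb2[OF _ fw, where ?c1.0 = 1 and ?c2.0 = "-1"])
      (unfold quad_def, Groebner_Basis.algebra)
  \<comment> \<open>For vanishing \<open>c\<close>, \<open>quad\<close> would be a quadratic in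
    \<open>x\<close> alone with roots \<open>x1\<close> and \<open>x2\<close>, and could not vanish
    at \<open>x3\<close>.\<close>
  moreover have "\<not> c \<equiv>\<^sub>l 0"
  proof
    assume "c \<equiv>\<^sub>l 0"
    then have "(x1 - x3) * (x3 - x2) \<equiv>\<^sub>l 0"
      by (rule cong_lincomb4[OF _ d f1 f3, where ?c1.0 = "y1 - y3 - s * (x1 - x3)"
            and ?c2.0 = "- (x1 - x3)" and ?c3.0 = 1 and ?c4.0 = "-1"])
        (unfold quad_def, Groebner_Basis.algebra)
    from mult_cong_0_cases[OF this] show False
      unfolding cong_diff_iff_cong_0 using x13 x23 cong_sym by blast
  qed
  ultimately have "m * w + k - (m' * w' + k') \<equiv>\<^sub>l 0"
    using mult_cong_0_cases by blast
  then show ?thesis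
    using ww unfolding cong_diff_iff_cong_0 by blast
qed

section \<open>The commutative group of points\<close>

definition points :: "point set" where
  "points = insert Infinity {pt x y | x y. on_curve x y}"

fun neg :: "point \<Rightarrow> point" where
  "neg (Affine x y) = Affine x ((- y) mod l)"
| "neg P = P"

abbreviation padd :: "point \<Rightarrow> point \<Rightarrow> point" (infixl "\<oplus>\<^sub>l" 65) where
  "P \<oplus>\<^sub>l Q \<equiv> add_points l a P Q"

lemma neg_pt: "neg (pt x y) = pt x (- y)"
  by (simp add: pt_def mod_minus_eq)

lemma on_curve_cong: "x \<equiv>\<^sub>l x' \<Longrightarrow> y \<equiv>\<^sub>l y' \<Longrightarrow> on_curve x y \<longleftrightarrow> on_curve x' y'"
  unfolding on_curve_def
  by (meson cong_add cong_mult cong_pow cong_refl cong_sym cong_trans)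

lemma pt_in_points [simp]: "pt x y \<in> points \<longleftrightarrow> on_curve x y"
proof
  assume "on_curve x y"
  then show "pt x y \<in> points" unfolding points_def by blast
qed (auto simp: points_def pt_eq_iff on_curve_cong)

lemma Infinity_in_points [simp]: "Infinity \<in> points"
  by (simp add: points_def)

lemma points_cases [case_names Infinity pt]:
  assumes "P \<in> points"
  obtains "P = Infinity" | x y where "P = pt x y" "on_curve x y"
  using assms unfolding points_def by blast

lemma on_curve_neg: "on_curve x (- y) \<longleftrightarrow> on_curve x y"
  by (simp add: on_curve_def)

lemma neg_in_points: "P \<in> points \<Longrightarrow> neg P \<in> points"
  by (erule points_cases) (auto simp: neg_pt on_curve_neg)

lemma neg_neg: "P \<in> points \<Longrightarrow> neg (neg P) = P"
  by (erule points_cases) (auto simp: neg_pt)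

lemma add_Infinity [simp]:
  "P \<in> points \<Longrightarrow> Infinity \<oplus>\<^sub>l P = P" "P \<in> points \<Longrightarrow> P \<oplus>\<^sub>l Infinity = P"
  by (auto simp: pt_def elim!: points_cases)

lemma line_cuts_tangent:
  assumes "line_cuts s t x1 x2 x3" "x1 \<equiv>\<^sub>l x2"
  shows "s * (2 * (s * x1 + t)) \<equiv>\<^sub>l 3 * x1\<^sup>2 + a"
  by (rule cong_lincomb3[OF line_cutsD(1,2)[OF assms(1)] assms(2), where ?c1.0 = "2 * x1"
        and ?c2.0 = "-1" and ?c3.0 = "- (x1 - x3)"]) Groebner_Basis.algebra

text \<open>Nonsingularity enters here: a double intersection with ordinate 0 on a non-vertical line
  would make \<open>x1\<close> a double root of the cubic, so that the discriminant
  vanishes.\<close>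

lemma line_cuts_not_opposite:
  assumes L: "line_cuts s t x1 x2 x3" and x: "x1 \<equiv>\<^sub>l x2"
  shows "\<not> 2 * (s * x1 + t) \<equiv>\<^sub>l 0"
proof
  assume *: "2 * (s * x1 + t) \<equiv>\<^sub>l 0"
  then have y: "s * x1 + t \<equiv>\<^sub>l 0" using mult_cong_0_cases two_neq_0 by blast
  have a: "a \<equiv>\<^sub>l - 3 * x1\<^sup>2"
    by (rule cong_lincomb2[OF line_cuts_tangent[OF assms] *, where ?c1.0 = "-1" and ?c2.0 = s])
      Groebner_Basis.algebra
  have b: "b \<equiv>\<^sub>l 2 * x1 ^ 3"
    by (rule cong_lincomb3[OF line_cuts_on_curve(1)[OF L, unfolded on_curve_def] a y,
          where ?c1.0 = "-1" and ?c2.0 = "- x1" and ?c3.0 = "s * x1 + t"]) Groebner_Basis.algebra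
  have "4 * a ^ 3 + 27 * b\<^sup>2 \<equiv>\<^sub>l 4 * (- 3 * x1\<^sup>2) ^ 3 + 27 * (2 * x1 ^ 3)\<^sup>2"
    using a b by (intro cong_add cong_mult cong_pow cong_refl)
  also have "4 * (- 3 * x1\<^sup>2) ^ 3 + 27 * (2 * x1 ^ 3)\<^sup>2 = 0" by Groebner_Basis.algebra
  finally show False using nonsingular by (simp add: cong_0_iff)
qed

text \<open>This ties \<open>line_cuts\<close> to the addition formulas. Chords and tangents give
  the same conclusion, so the generic associativity proof need not distinguish them.\<close>

lemma add_line:
  assumes L: "line_cuts s t x1 x2 x3" and y1: "y1 \<equiv>\<^sub>l s * x1 + t" and y2: "y2 \<equiv>\<^sub>l s * x2 + t"
    and y3: "y3 \<equiv>\<^sub>l - (s * x3 + t)"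
  shows "pt x1 y1 \<oplus>\<^sub>l pt x2 y2 = pt x3 y3"
proof -
  have y3': "y3 \<equiv>\<^sub>l s * (x1 - x3) - y1"
    by (rule cong_lincomb2[OF y1 y3, where ?c1.0 = 1 and ?c2.0 = 1]) Groebner_Basis.algebra
  have minus: "y1 mod l \<equiv>\<^sub>l - (y2 mod l) \<longleftrightarrow> y1 \<equiv>\<^sub>l - y2"
    by (simp add: cong_def mod_minus_eq)
  show ?thesis
  proof (cases "x1 \<equiv>\<^sub>l x2")
    case True
    have y12: "y1 \<equiv>\<^sub>l y2"
      by (rule cong_lincomb3[OF y1 y2 True, where ?c1.0 = 1 and ?c2.0 = "-1" and ?c3.0 = s])
        Groebner_Basis.algebra
    have dy: "2 * (y1 mod l) \<equiv>\<^sub>l 2 * (s * x1 + t)"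
      by (intro cong_mult cong_refl) (simp add: y1)
    have "\<not> y1 \<equiv>\<^sub>l - y2"
    proof
      assume *: "y1 \<equiv>\<^sub>l - y2"
      have "2 * (s * x1 + t) \<equiv>\<^sub>l 0"
        by (rule cong_lincomb3[OF * y12 y1, where ?c1.0 = 1 and ?c2.0 = 1 and ?c3.0 = "-2"])
          Groebner_Basis.algebra
      then show False using line_cuts_not_opposite[OF L True] by blast
    qed
    moreover have "slope_point l (x1 mod l) (y1 mod l) (x2 mod l)
        (3 * (x1 mod l)\<^sup>2 + a) (2 * (y1 mod l)) = pt x3 y3"
    proof (rule slope_point_eq[where s = s and x1' = x1 and x2' = x2 and y1' = y1])
      show "\<not> 2 * (y1 mod l) \<equiv>\<^sub>l 0"
        using cong_trans[OF cong_sym[OF dy]] line_cuts_not_opposite[OF L True] by blast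
      have "s * (2 * (y1 mod l)) \<equiv>\<^sub>l s * (2 * (s * x1 + t))"
        by (rule cong_mult[OF cong_refl dy])
      also have "s * (2 * (s * x1 + t)) \<equiv>\<^sub>l 3 * x1\<^sup>2 + a" by (rule line_cuts_tangent[OF L True])
      also have "3 * x1\<^sup>2 + a \<equiv>\<^sub>l 3 * (x1 mod l)\<^sup>2 + a"
        by (intro cong_add cong_mult cong_pow cong_refl) simp
      finally show "s * (2 * (y1 mod l)) \<equiv>\<^sub>l 3 * (x1 mod l)\<^sup>2 + a" .
    qed (use line_cutsD(1)[OF L] y3' in auto)
    ultimately show ?thesis using True y12 minus by (simp add: pt_def)
  next
    case False
    have "slope_point l (x1 mod l) (y1 mod l) (x2 mod l) (y2 mod l - y1 mod l)
        (x2 mod l - x1 mod l) = pt x3 y3"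
    proof (rule slope_point_eq[where s = s and x1' = x1 and x2' = x2 and y1' = y1])
      show "\<not> x2 mod l - x1 mod l \<equiv>\<^sub>l 0"
        using False cong_diff_iff_cong_0 cong_sym by (metis cong_mod_left cong_mod_right)
      have "s * (x2 - x1) \<equiv>\<^sub>l y2 - y1"
        by (rule cong_lincomb2[OF y1 y2, where ?c1.0 = 1 and ?c2.0 = "-1"]) Groebner_Basis.algebra
      moreover have "s * (x2 mod l - x1 mod l) \<equiv>\<^sub>l s * (x2 - x1)"
        "y2 - y1 \<equiv>\<^sub>l y2 mod l - y1 mod l"
        by (intro cong_mult cong_diff cong_refl; simp)+
      ultimately show "s * (x2 mod l - x1 mod l) \<equiv>\<^sub>l y2 mod l - y1 mod l"
        using cong_trans by blast
    qed (use line_cutsD(1)[OF L] y3' in auto)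
    then show ?thesis using False by (simp add: pt_def)
  qed
qed

lemma add_ptE:
  assumes "on_curve x1 y1" "on_curve x2 y2" "pt x1 y1 \<oplus>\<^sub>l pt x2 y2 \<noteq> Infinity"
  obtains s t x3 where "line_cuts s t x1 x2 x3" "y1 \<equiv>\<^sub>l s * x1 + t" "y2 \<equiv>\<^sub>l s * x2 + t"
    "pt x1 y1 \<oplus>\<^sub>l pt x2 y2 = pt x3 (- (s * x3 + t))" "on_curve x3 (- (s * x3 + t))"
proof -
  have "\<not> (x1 \<equiv>\<^sub>l x2 \<and> y1 \<equiv>\<^sub>l - y2)" using assms(3) add_opposite by blast
  from slope_exists[OF assms(1,2) this] obtain s t x3
    where *: "y1 \<equiv>\<^sub>l s * x1 + t" "y2 \<equiv>\<^sub>l s * x2 + t" "line_cuts s t x1 x2 x3" by blast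
  with that[OF *(3,1,2) add_line[OF *(3,1,2) cong_refl]] line_cuts_on_curve(3)[OF *(3)]
  show ?thesis by (simp only: on_curve_neg)
qed

lemma add_in_points: "P \<in> points \<Longrightarrow> Q \<in> points \<Longrightarrow> P \<oplus>\<^sub>l Q \<in> points"
  by (elim points_cases) (auto, metis Infinity_in_points add_ptE pt_in_points)

lemma add_eq_InfinityD:
  assumes "on_curve x1 y1" "on_curve x2 y2" "pt x1 y1 \<oplus>\<^sub>l pt x2 y2 = Infinity"
  shows "x1 \<equiv>\<^sub>l x2 \<and> y1 \<equiv>\<^sub>l - y2"
  using slope_exists[OF assms(1,2)] add_line assms(3) pt_neq_Infinity by (metis cong_refl)

lemma add_eq_Infinity_iff:
  assumes "P \<in> points" "Q \<in> points"
  shows "P \<oplus>\<^sub>l Q = Infinity \<longleftrightarrow> P = neg Q"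
  using assms add_eq_InfinityD add_opposite
  by (elim points_cases) (auto simp: neg_pt pt_eq_iff)

lemma add_commute:
  assumes "P \<in> points" "Q \<in> points"
  shows "P \<oplus>\<^sub>l Q = Q \<oplus>\<^sub>l P"
proof (cases "P \<oplus>\<^sub>l Q = Infinity")
  case True
  then have "P = neg Q" using add_eq_Infinity_iff assms by blast
  then have "Q = neg P" using neg_neg assms by simp
  then show ?thesis using True add_eq_Infinity_iff assms by metis
next
  case False
  from assms(1) show ?thesis
  proof (cases rule: points_cases)
    case Infinity
    then show ?thesis using assms by simp
  next
    case P: (pt x1 y1)
    from assms(2) show ?thesis
    proof (cases rule: points_cases)
      case Infinity
      then show ?thesis using assms by simp
    next
      case (pt x2 y2)
      with P False obtain s t x3 where "line_cuts s t x1 x2 x3" "y1 \<equiv>\<^sub>l s * x1 + t"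
        "y2 \<equiv>\<^sub>l s * x2 + t" "P \<oplus>\<^sub>l Q = pt x3 (- (s * x3 + t))"
        using add_ptE by metis
      then show ?thesis using add_line[OF line_cuts_swap12] P pt by (metis cong_refl)
    qed
  qed
qed

text \<open>The line through \<open>P\<close> and \<open>Q\<close>, reflected in the x-axis, passes
  through \<open>neg P\<close>, \<open>neg Q\<close> and \<open>P \<oplus>\<^sub>l Q\<close>. Adding
  different pairs on it gives both claims, without associativity.\<close>

lemma add_neg_cancel:
  assumes "P \<in> points" "Q \<in> points"
  shows "P \<oplus>\<^sub>l Q \<oplus>\<^sub>l neg Q = P" and "neg (P \<oplus>\<^sub>l Q) = neg P \<oplus>\<^sub>l neg Q"
proof -
  have "P \<oplus>\<^sub>l Q \<oplus>\<^sub>l neg Q = P \<and> neg (P \<oplus>\<^sub>l Q) = neg P \<oplus>\<^sub>l neg Q"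
  proof (cases "P \<oplus>\<^sub>l Q = Infinity")
    case True
    then have P: "P = neg Q" using add_eq_Infinity_iff assms by blast
    have "Q \<oplus>\<^sub>l neg Q = Infinity"
      using add_eq_Infinity_iff[of Q "neg Q"] neg_neg assms neg_in_points by simp
    then show ?thesis using True P neg_in_points[OF assms(2)] neg_neg[OF assms(2)] by simp
  next
    case False
    from assms(1) show ?thesis
    proof (cases rule: points_cases)
      case Infinity
      then show ?thesis using assms neg_in_points add_eq_Infinity_iff neg_neg by auto
    next
      case P: (pt x1 y1)
      from assms(2) show ?thesis
      proof (cases rule: points_cases)
        case Infinity
        then show ?thesis using assms neg_in_points by auto
      next
        case (pt x2 y2)
        with P False obtain s t x3 where L: "line_cuts s t x1 x2 x3" and y: "y1 \<equiv>\<^sub>l s * x1 + t"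
          "y2 \<equiv>\<^sub>l s * x2 + t" and PQ: "P \<oplus>\<^sub>l Q = pt x3 (- (s * x3 + t))"
          using add_ptE by metis
        have N: "line_cuts (- s) (- t) x1 x2 x3" using L line_cuts_neg by blast
        have y': "- y1 \<equiv>\<^sub>l - s * x1 + - t" "- y2 \<equiv>\<^sub>l - s * x2 + - t"
          using y by (metis cong_minus_minus_iff minus_add_distrib mult_minus_left)+
        have "neg P \<oplus>\<^sub>l neg Q = neg (P \<oplus>\<^sub>l Q)"
          unfolding PQ unfolding P(1) pt(1) neg_pt by (rule add_line[OF N y']) simp
        moreover have "P \<oplus>\<^sub>l Q \<oplus>\<^sub>l neg Q = P"
          unfolding PQ unfolding P(1) pt(1) neg_pt
          by (rule add_line[OF line_cuts_swap12[OF line_cuts_swap23[OF line_cuts_swap12[OF N]]] _ y'(2)])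
            (use y in \<open>simp_all add: add.commute\<close>)
        ultimately show ?thesis by simp
      qed
    qed
  qed
  then show "P \<oplus>\<^sub>l Q \<oplus>\<^sub>l neg Q = P" "neg (P \<oplus>\<^sub>l Q) = neg P \<oplus>\<^sub>l neg Q" by auto
qed

lemma add_assoc_generic:
  assumes P: "on_curve x1 y1" "on_curve x2 y2" "on_curve x3 y3"
    and x: "\<not> x1 \<equiv>\<^sub>l x3" "\<not> x2 \<equiv>\<^sub>l x3"
    and nz: "pt x1 y1 \<oplus>\<^sub>l pt x2 y2 \<noteq> Infinity" "pt x2 y2 \<oplus>\<^sub>l pt x3 y3 \<noteq> Infinity"
      "pt x1 y1 \<oplus>\<^sub>l pt x2 y2 \<oplus>\<^sub>l pt x3 y3 \<noteq> Infinity"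
      "pt x1 y1 \<oplus>\<^sub>l (pt x2 y2 \<oplus>\<^sub>l pt x3 y3) \<noteq> Infinity"
  shows "pt x1 y1 \<oplus>\<^sub>l pt x2 y2 \<oplus>\<^sub>l pt x3 y3 = pt x1 y1 \<oplus>\<^sub>l (pt x2 y2 \<oplus>\<^sub>l pt x3 y3)"
proof -
  obtain s t u where L: "line_cuts s t x1 x2 u" "y1 \<equiv>\<^sub>l s * x1 + t" "y2 \<equiv>\<^sub>l s * x2 + t"
    and P12: "pt x1 y1 \<oplus>\<^sub>l pt x2 y2 = pt u (- (s * u + t))" "on_curve u (- (s * u + t))"
    using add_ptE[OF P(1,2) nz(1)] by blast
  obtain s' t' u' where L': "line_cuts s' t' x2 x3 u'" "y2 \<equiv>\<^sub>l s' * x2 + t'" "y3 \<equiv>\<^sub>l s' * x3 + t'"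
    and P23: "pt x2 y2 \<oplus>\<^sub>l pt x3 y3 = pt u' (- (s' * u' + t'))" "on_curve u' (- (s' * u' + t'))"
    using add_ptE[OF P(2,3) nz(2)] by blast
  obtain m k w where M: "line_cuts m k u x3 w" "- (s * u + t) \<equiv>\<^sub>l m * u + k" "y3 \<equiv>\<^sub>l m * x3 + k"
    and PL: "pt u (- (s * u + t)) \<oplus>\<^sub>l pt x3 y3 = pt w (- (m * w + k))"
    using add_ptE[OF P12(2) P(3) nz(3)[unfolded P12(1)]] by blast
  obtain m' k' w' where M': "line_cuts m' k' x1 u' w'" "y1 \<equiv>\<^sub>l m' * x1 + k'"
    "- (s' * u' + t') \<equiv>\<^sub>l m' * u' + k'"
    and PR: "pt x1 y1 \<oplus>\<^sub>l pt u' (- (s' * u' + t')) = pt w' (- (m' * w' + k'))"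
    using add_ptE[OF P(1) P23(2) nz(4)[unfolded P23(1)]] by blast
  have n12: "\<not> (x1 \<equiv>\<^sub>l x2 \<and> y1 \<equiv>\<^sub>l - y2)" using add_opposite nz(1) by blast
  have "\<not> (u \<equiv>\<^sub>l x3 \<and> - (s * u + t) \<equiv>\<^sub>l - y3)" using add_opposite nz(3) P12(1) by metis
  then have nu: "\<not> (x3 \<equiv>\<^sub>l u \<and> y3 \<equiv>\<^sub>l s * u + t)"
    by (metis cong_minus_minus_iff cong_sym)
  have nu': "\<not> (x1 \<equiv>\<^sub>l u' \<and> y1 \<equiv>\<^sub>l s' * u' + t')"
    using add_opposite[of x1 u' y1 "- (s' * u' + t')"] nz(4) P23(1)
    by (metis minus_minus)
  have "w \<equiv>\<^sub>l w' \<and> m * w + k \<equiv>\<^sub>l m' * w' + k'"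
    by (rule chord_assoc[OF L(1) M(1) L'(1) M'(1) L(2) M'(2) L(3) L'(2) M(3) L'(3) M(2) M'(3)
          x n12 nu nu'])
  then have "pt w (- (m * w + k)) = pt w' (- (m' * w' + k'))"
    unfolding pt_eq_iff cong_minus_minus_iff .
  then show ?thesis unfolding P12(1) P23(1) PL PR .
qed

text \<open>Here \<open>R\<close> is \<open>neg P \<oplus>\<^sub>l neg Q\<close>, so cancellation
  turns \<open>Q \<oplus>\<^sub>l R\<close> into \<open>neg P\<close>.\<close>

lemma add_assoc_if_sum_Infinity:
  assumes "P \<in> points" "Q \<in> points" "R \<in> points" "P \<oplus>\<^sub>l Q \<oplus>\<^sub>l R = Infinity"
  shows "P \<oplus>\<^sub>l (Q \<oplus>\<^sub>l R) = Infinity"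
proof -
  note in_points = assms(1-3) neg_in_points add_in_points
  have "R = neg (P \<oplus>\<^sub>l Q)"
    using add_eq_Infinity_iff[of "P \<oplus>\<^sub>l Q" R] assms neg_neg in_points by metis
  then have "R = neg P \<oplus>\<^sub>l neg Q" using add_neg_cancel(2) in_points by simp
  then have "Q \<oplus>\<^sub>l R = neg P"
    using add_neg_cancel(1)[of "neg P" "neg Q"] add_commute[of Q R] neg_neg in_points by simp
  then show ?thesis using add_eq_Infinity_iff[of P "neg P"] neg_neg in_points by simp
qed

lemma add_assoc_if_partial_sum_Infinity:
  assumes "P \<in> points" "Q \<in> points" "R \<in> points" "P \<oplus>\<^sub>l Q = Infinity"
  shows "P \<oplus>\<^sub>l Q \<oplus>\<^sub>l R = P \<oplus>\<^sub>l (Q \<oplus>\<^sub>l R)"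
proof -
  note in_points = assms(1-3) neg_in_points add_in_points
  have "P = neg Q" using add_eq_Infinity_iff assms by blast
  then have "P \<oplus>\<^sub>l (Q \<oplus>\<^sub>l R) = R \<oplus>\<^sub>l Q \<oplus>\<^sub>l neg Q"
    using add_commute[of R Q] add_commute[of P "R \<oplus>\<^sub>l Q"] in_points by simp
  then show ?thesis using add_neg_cancel(1) assms by simp
qed

text \<open>The degenerate cases follow from commutativity and cancellation. Otherwise
  \<open>P\<close> is neither \<open>R\<close> nor \<open>neg R\<close>, so \<open>x1\<close> and
  \<open>x3\<close> differ, and only a coincidence of \<open>x2\<close> with \<open>x3\<close>
  remains in the way of \<open>add_assoc_generic\<close>.\<close>

lemma add_assoc:
  assumes PQR: "P \<in> points" "Q \<in> points" "R \<in> points"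
  shows "P \<oplus>\<^sub>l Q \<oplus>\<^sub>l R = P \<oplus>\<^sub>l (Q \<oplus>\<^sub>l R)"
proof -
  note in_points = PQR neg_in_points add_in_points
  have rev: "P \<oplus>\<^sub>l (Q \<oplus>\<^sub>l R) = R \<oplus>\<^sub>l Q \<oplus>\<^sub>l P" "R \<oplus>\<^sub>l (Q \<oplus>\<^sub>l P) = P \<oplus>\<^sub>l Q \<oplus>\<^sub>l R"
    using add_commute[of R Q] add_commute[of P "R \<oplus>\<^sub>l Q"] add_commute[of P Q]
      add_commute[of R "P \<oplus>\<^sub>l Q"] in_points by simp_all
  consider "P \<oplus>\<^sub>l Q = Infinity" | "Q \<oplus>\<^sub>l R = Infinity" | "P \<oplus>\<^sub>l Q \<oplus>\<^sub>l R = Infinity"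
    | "P \<oplus>\<^sub>l (Q \<oplus>\<^sub>l R) = Infinity" | "P = R" | "P = neg R" | "P = Infinity"
    | "Q = Infinity" | "R = Infinity"
    | (generic) "P \<oplus>\<^sub>l Q \<noteq> Infinity" "Q \<oplus>\<^sub>l R \<noteq> Infinity" "P \<oplus>\<^sub>l Q \<oplus>\<^sub>l R \<noteq> Infinity"
      "P \<oplus>\<^sub>l (Q \<oplus>\<^sub>l R) \<noteq> Infinity" "P \<noteq> R" "P \<noteq> neg R" "P \<noteq> Infinity" "Q \<noteq> Infinity"
      "R \<noteq> Infinity"
    by blast
  then show ?thesis
  proof cases
    case 1
    then show ?thesis using add_assoc_if_partial_sum_Infinity PQR by blast
  next
    case 2
    then have "R \<oplus>\<^sub>l Q = Infinity" using add_commute PQR by simp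
    then show ?thesis using add_assoc_if_partial_sum_Infinity[of R Q P] rev PQR by simp
  next
    case 3
    then show ?thesis using add_assoc_if_sum_Infinity PQR by simp
  next
    case 4
    then show ?thesis using add_assoc_if_sum_Infinity[of R Q P] rev PQR by simp
  next
    case 5
    then show ?thesis using add_commute[of P Q] add_commute[of P "P \<oplus>\<^sub>l Q"] in_points by simp
  next
    case 6
    then have "R = neg P" using neg_neg PQR by simp
    then show ?thesis
      using 6 add_neg_cancel(1)[of Q P] add_neg_cancel(1)[of Q R] add_commute[of P Q]
        add_commute[of P "Q \<oplus>\<^sub>l R"] in_points by simp
  next
    case generic
    obtain x1 y1 where P: "P = pt x1 y1" "on_curve x1 y1"
      using PQR(1) generic points_cases by metis
    obtain x2 y2 where Q: "Q = pt x2 y2" "on_curve x2 y2"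
      using PQR(2) generic points_cases by metis
    obtain x3 y3 where R: "R = pt x3 y3" "on_curve x3 y3"
      using PQR(3) generic points_cases by metis
    have x13: "\<not> x1 \<equiv>\<^sub>l x3"
      using on_curve_same_x[OF P(2) R(2)] generic(5,6) P(1) R(1) neg_pt pt_eq_iff by metis
    show ?thesis
    proof (cases "x2 \<equiv>\<^sub>l x3")
      case False
      then show ?thesis
        using add_assoc_generic[OF P(2) Q(2) R(2) x13 False] generic P Q R by simp
    next
      case True
      \<comment> \<open>Equal abscissae without a vanishing sum force \<open>Q = R\<close>.
        Reversing the order puts the repeated point first, where \<open>add_assoc_generic\<close>
        admits it.\<close>
      have "\<not> y2 \<equiv>\<^sub>l - y3" using add_opposite[OF True] generic(2) Q R by blast
      then have QR: "Q = R"
        using on_curve_same_x[OF Q(2) R(2) True] True Q R pt_eq_iff by blast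
      then have x12: "\<not> x2 \<equiv>\<^sub>l x1" using x13 Q R pt_eq_iff cong_sym cong_trans by metis
      have "Q \<oplus>\<^sub>l Q \<oplus>\<^sub>l P = Q \<oplus>\<^sub>l (Q \<oplus>\<^sub>l P)"
        using add_assoc_generic[OF Q(2) Q(2) P(2) x12 x12] generic(1-4) rev QR P(1) Q(1)
          add_commute[OF PQR(1,2)] by metis
      then show ?thesis using rev QR by simp
    qed
  qed (use PQR add_in_points in auto)
qed

definition curve_group :: "point monoid" where
  "curve_group = \<lparr>carrier = points, mult = add_points l a, one = Infinity\<rparr>"

lemma curve_group_simps [simp]:
  "carrier curve_group = points" "mult curve_group = add_points l a" "one curve_group = Infinity"
  by (simp_all add: curve_group_def)

sublocale curve_group: comm_group curve_group
proof (rule comm_groupI)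
  fix P assume "P \<in> carrier curve_group"
  then show "\<exists>Q\<in>carrier curve_group. Q \<otimes>\<^bsub>curve_group\<^esub> P = \<one>\<^bsub>curve_group\<^esub>"
    using neg_in_points add_eq_Infinity_iff by auto
qed (auto simp: add_in_points add_assoc intro: add_commute)

section \<open>Number of points\<close>

lemma on_curve_mod: "on_curve (x mod l) (y mod l) \<longleftrightarrow> on_curve x y"
  by (rule on_curve_cong) simp_all

lemma points_eq:
  "points = insert Infinity ((\<lambda>(x, y). Affine x y) `
     (SIGMA x:{0..<l}. {y \<in> {0..<l}. [y\<^sup>2 = x ^ 3 + a * x + b] (mod l)}))" (is "_ = insert _ (_ ` ?A)")
proof (intro equalityI subsetI)
  fix P assume "P \<in> points"
  then show "P \<in> insert Infinity ((\<lambda>(x, y). Affine x y) ` ?A)"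
  proof (cases rule: points_cases)
    case (pt x y)
    have "(x mod l, y mod l) \<in> ?A"
      using pt(2) l_gt_2 on_curve_mod[of x y, unfolded on_curve_def] by (simp add: on_curve_def)
    then have "Affine (x mod l) (y mod l) \<in> (\<lambda>(x, y). Affine x y) ` ?A"
      by (rule rev_image_eqI) simp
    then show ?thesis using pt(1) by (simp only: pt_def insert_iff simp_thms)
  qed simp
next
  fix P assume "P \<in> insert Infinity ((\<lambda>(x, y). Affine x y) ` ?A)"
  then consider "P = Infinity" | x y where "P = Affine x y" "(x, y) \<in> ?A" by auto
  then show "P \<in> points"
  proof cases
    case 2
    then have "P = pt x y" "on_curve x y" by (auto simp: pt_def on_curve_def)
    then show ?thesis by simp
  qed simp
qed

lemma finite_solutions:
  "finite (SIGMA x:{0..<l}. {y \<in> {0..<l}. [y\<^sup>2 = x ^ 3 + a * x + b] (mod l)})"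
  by (rule finite_subset[of _ "{0..<l} \<times> {0..<l}"]) auto

lemma finite_points: "finite points"
  unfolding points_eq using finite_solutions by blast

lemma card_points: "int (card points) = l + 1 + (\<Sum>x = 0..<l. \<chi> (x ^ 3 + a * x + b))"
proof -
  let ?A = "SIGMA x:{0..<l}. {y \<in> {0..<l}. [y\<^sup>2 = x ^ 3 + a * x + b] (mod l)}"
  have inj: "inj_on (\<lambda>(x, y). Affine x y) ?A" by (auto simp: inj_on_def)
  have Inf: "Infinity \<notin> (\<lambda>(x, y). Affine x y) ` ?A" by auto
  have "card points = 1 + card ?A"
    unfolding points_eq card_insert_disjoint[OF finite_imageI[OF finite_solutions] Inf]
      card_image[OF inj] by simp
  also have "card ?A = (\<Sum>x = 0..<l. card {y \<in> {0..<l}. [y\<^sup>2 = x ^ 3 + a * x + b] (mod l)})"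
    by (intro card_SigmaI ballI finite_Collect_conjI disjI1) auto
  also have "int (1 + \<dots>) = 1 + (\<Sum>x = 0..<l. 1 + \<chi> (x ^ 3 + a * x + b))"
    by (simp only: of_nat_add of_nat_1 of_nat_sum card_sqrt_mod)
  also have "\<dots> = l + 1 + (\<Sum>x = 0..<l. \<chi> (x ^ 3 + a * x + b))"
    using l_gt_2 by (simp add: sum.distrib)
  finally show ?thesis .
qed

text \<open>In a group the order of the additions is irrelevant, so the relation determines a unique
  outcome.\<close>

lemma is_multiple_eq_pow:
  assumes "is_multiple l a P i R" "P \<in> points"
  shows "R = P [^]\<^bsub>curve_group\<^esub> i"
  using assms
proof (induction rule: is_multiple.induct)
  case (add i R j S)
  then show ?case using curve_group.nat_pow_mult[of P i j] by simp
qed (use curve_group.nat_pow_0[of P] curve_group.nat_pow_eone in auto)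

section \<open>Reduction modulo a prime divisor\<close>

fun reduce :: "point \<Rightarrow> point" where
  "reduce (Affine x y) = pt x y"
| "reduce P = P"

text \<open>A defined outcome means that the denominator is a unit modulo \<open>p\<close>, hence
  also modulo its prime divisor \<open>l\<close>.\<close>

lemma slope_pointE:
  fixes p :: int
  assumes "slope_point p x1 y1 x2 num den \<noteq> Undefined" "l dvd p"
  obtains s x3 y3 where "slope_point p x1 y1 x2 num den = Affine x3 y3" "\<not> den \<equiv>\<^sub>l 0"
    "s * den \<equiv>\<^sub>l num" "s\<^sup>2 \<equiv>\<^sub>l x1 + x2 + x3" "y3 \<equiv>\<^sub>l s * (x1 - x3) - y1"
proof -
  have cop: "coprime den p" using assms(1) by (auto simp: slope_point_def split: if_splits)
  define s where "s = num * modular_inverse p den"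
  define x3 where "x3 = (s\<^sup>2 - x1 - x2) mod p"
  have modl: "z mod p \<equiv>\<^sub>l z" for z
    using assms(2) by (meson cong_dvd_modulus cong_mod_left cong_refl)
  show ?thesis
  proof
    show "slope_point p x1 y1 x2 num den = Affine x3 ((s * (x1 - x3) - y1) mod p)"
      using cop by (simp add: slope_point_def s_def x3_def Let_def)
    show "\<not> den \<equiv>\<^sub>l 0"
      using cop assms(2) prime_l by (metis cong_0_iff coprime_common_divisor not_prime_unit)
    have inv: "den * modular_inverse p den \<equiv>\<^sub>l 1"
      by (rule cong_dvd_modulus[OF cong_modular_inverse1[OF cop] assms(2)])
    show "s * den \<equiv>\<^sub>l num"
      by (rule cong_lincomb1[OF inv, where ?c1.0 = num]) (simp add: s_def algebra_simps)
    show "s\<^sup>2 \<equiv>\<^sub>l x1 + x2 + x3"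
      by (rule cong_lincomb1[OF modl[of "s\<^sup>2 - x1 - x2"], where ?c1.0 = "- 1"])
        (simp add: x3_def algebra_simps)
    show "(s * (x1 - x3) - y1) mod p \<equiv>\<^sub>l s * (x1 - x3) - y1" by (rule modl)
  qed
qed

text \<open>A defined sum falls into the same case modulo \<open>l\<close> as modulo
  \<open>p\<close>: a doubling keeps \<open>2 * y1\<close> nonzero and a chord keeps the abscissae
  distinct.\<close>

lemma reduce_add_Affine:
  assumes p: "l dvd p" and nu: "add_points p a (Affine x1 y1) (Affine x2 y2) \<noteq> Undefined"
  shows "reduce (add_points p a (Affine x1 y1) (Affine x2 y2)) = pt x1 y1 \<oplus>\<^sub>l pt x2 y2"
proof -
  have minus: "y1 mod l \<equiv>\<^sub>l - (y2 mod l) \<longleftrightarrow> y1 \<equiv>\<^sub>l - y2"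
    by (simp add: cong_def mod_minus_eq)
  consider (opposite) "[x1 = x2] (mod p)" "[y1 = - y2] (mod p)"
    | (double) "[x1 = x2] (mod p)" "\<not> [y1 = - y2] (mod p)" "[y1 = y2] (mod p)"
    | (chord) "\<not> ([x1 = x2] (mod p) \<and> [y1 = - y2] (mod p))"
      "\<not> ([x1 = x2] (mod p) \<and> [y1 = y2] (mod p))"
    by blast
  then show ?thesis
  proof cases
    case opposite
    from add_opposite[of x1 x2 y1 y2 a, OF this[THEN cong_dvd_modulus[OF _ p]]]
    show ?thesis using opposite by simp
  next
    case double
    then have sum: "add_points p a (Affine x1 y1) (Affine x2 y2) =
        slope_point p x1 y1 x2 (3 * x1\<^sup>2 + a) (2 * y1)" by simp
    obtain s x3 y3 where *: "add_points p a (Affine x1 y1) (Affine x2 y2) = Affine x3 y3"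
      "\<not> 2 * y1 \<equiv>\<^sub>l 0" "s * (2 * y1) \<equiv>\<^sub>l 3 * x1\<^sup>2 + a" "s\<^sup>2 \<equiv>\<^sub>l x1 + x2 + x3" "y3 \<equiv>\<^sub>l s * (x1 - x3) - y1"
      using slope_pointE[OF nu[unfolded sum] p] unfolding sum .
    have eq: "x1 \<equiv>\<^sub>l x2" "y1 \<equiv>\<^sub>l y2" using double cong_dvd_modulus p by blast+
    have "\<not> y1 \<equiv>\<^sub>l - y2"
    proof
      assume "y1 \<equiv>\<^sub>l - y2"
      from cong_add[OF this eq(2)] *(2) show False by simp
    qed
    moreover have "slope_point l (x1 mod l) (y1 mod l) (x2 mod l)
        (3 * (x1 mod l)\<^sup>2 + a) (2 * (y1 mod l)) = pt x3 y3"
    proof (rule slope_point_eq[where s = s and x1' = x1 and x2' = x2 and y1' = y1])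
      have y: "2 * (y1 mod l) \<equiv>\<^sub>l 2 * y1" by (intro cong_mult cong_refl) simp
      show "\<not> 2 * (y1 mod l) \<equiv>\<^sub>l 0"
        using cong_trans[OF cong_sym[OF y]] *(2) by blast
      have "3 * x1\<^sup>2 + a \<equiv>\<^sub>l 3 * (x1 mod l)\<^sup>2 + a"
        by (intro cong_add cong_mult cong_pow cong_refl) simp
      from cong_trans[OF cong_trans[OF cong_mult[OF cong_refl y] *(3)] this]
      show "s * (2 * (y1 mod l)) \<equiv>\<^sub>l 3 * (x1 mod l)\<^sup>2 + a" .
    qed (use * in auto)
    ultimately show ?thesis unfolding *(1) using eq minus by (simp add: pt_def)
  next
    case chord
    then have sum: "add_points p a (Affine x1 y1) (Affine x2 y2) =
        slope_point p x1 y1 x2 (y2 - y1) (x2 - x1)" by auto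
    obtain s x3 y3 where *: "add_points p a (Affine x1 y1) (Affine x2 y2) = Affine x3 y3"
      "\<not> x2 - x1 \<equiv>\<^sub>l 0" "s * (x2 - x1) \<equiv>\<^sub>l y2 - y1" "s\<^sup>2 \<equiv>\<^sub>l x1 + x2 + x3" "y3 \<equiv>\<^sub>l s * (x1 - x3) - y1"
      using slope_pointE[OF nu[unfolded sum] p] unfolding sum .
    have neq: "\<not> x1 \<equiv>\<^sub>l x2" using *(2) unfolding cong_diff_iff_cong_0 by (auto dest: cong_sym)
    have "slope_point l (x1 mod l) (y1 mod l) (x2 mod l) (y2 mod l - y1 mod l)
        (x2 mod l - x1 mod l) = pt x3 y3"
    proof (rule slope_point_eq[where s = s and x1' = x1 and x2' = x2 and y1' = y1])
      have x: "x2 mod l - x1 mod l \<equiv>\<^sub>l x2 - x1" by (intro cong_diff) simp_all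
      show "\<not> x2 mod l - x1 mod l \<equiv>\<^sub>l 0"
        using cong_trans[OF cong_sym[OF x]] *(2) by blast
      have "y2 - y1 \<equiv>\<^sub>l y2 mod l - y1 mod l" by (intro cong_diff) simp_all
      from cong_trans[OF cong_trans[OF cong_mult[OF cong_refl x] *(3)] this]
      show "s * (x2 mod l - x1 mod l) \<equiv>\<^sub>l y2 mod l - y1 mod l" .
    qed (use * in auto)
    then show ?thesis unfolding *(1) using neq by (simp add: pt_def)
  qed
qed

lemma reduce_add:
  assumes "l dvd p" "add_points p a P Q \<noteq> Undefined"
  shows "reduce (add_points p a P Q) = reduce P \<oplus>\<^sub>l reduce Q"
proof (cases "\<exists>x1 y1 x2 y2. P = Affine x1 y1 \<and> Q = Affine x2 y2")
  case True
  then show ?thesis using reduce_add_Affine assms by (auto simp only: reduce.simps)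
next
  case False
  then show ?thesis using assms(2) by (cases P; cases Q) (auto simp: pt_def)
qed

lemma add_points_Undefined_right: "add_points n c P Undefined = Undefined"
  by (cases P) auto

text \<open>Since \<open>Undefined\<close> absorbs every sum, a defined outcome has only defined
  intermediate results, and reduction commutes with each addition.\<close>

lemma reduce_is_multiple:
  assumes "is_multiple p a P i R" "l dvd p" "R \<noteq> Undefined"
  shows "is_multiple l a (reduce P) i (reduce R)"
  using assms
proof (induction rule: is_multiple.induct)
  case zero
  then show ?case using is_multiple.zero by simp
next
  case one
  then show ?case using is_multiple.one by simp
next
  case (add i R j S)
  then have "R \<noteq> Undefined" "S \<noteq> Undefined" using add_points_Undefined_right by auto
  then show ?case using add reduce_add is_multiple.add by metis
qed

end

section \<open>The primality test\<close>

text \<open>The condition \<open>i > 0\<close> excludes the empty sum. In the test this shows that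
  \<open>S\<close> is a point whenever \<open>T\<close> is \<open>Infinity\<close>.\<close>

lemma is_multiple_Undefined:
  assumes "is_multiple n c Undefined i R" "i > 0"
  shows "R = Undefined"
  using assms
proof (induction rule: is_multiple.induct)
  case (add i R j S)
  then show ?case by (cases "i = 0") (auto, cases R, auto)
qed auto

lemma Jacobi_nonzero:
  assumes "Jacobi c n \<noteq> 0" "prime l" "l dvd n" "n \<noteq> 0"
  shows "\<not> l dvd c"
proof
  assume "l dvd c"
  then have "Legendre c l = 0" by (simp add: Legendre_def cong_0_iff)
  moreover have "l \<in># prime_factorization n"
    using assms by (simp add: in_prime_factors_iff)
  ultimately have "Jacobi c n = 0" unfolding Jacobi_def by (auto simp: prod_mset_zero_iff image_iff)
  with assms(1) show False by blast
qed

lemma coprime_if_no_common_prime: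
  fixes c n :: int
  assumes "n \<noteq> 0" "\<And>l. prime l \<Longrightarrow> l dvd n \<Longrightarrow> \<not> l dvd c"
  shows "coprime c n"
proof (rule ccontr)
  assume "\<not> coprime c n"
  then have "\<not> is_unit (gcd c n)" by (simp only: is_unit_gcd) simp
  moreover have "gcd c n \<noteq> 0" using assms(1) by simp
  ultimately obtain l where "prime l" "l dvd gcd c n" using prime_divisor_exists by blast
  then show False using assms(2)[of l] by auto
qed

lemma prime_divisor_le_sqrt:
  fixes n :: int
  assumes "n > 1" "\<not> prime n"
  obtains l where "prime l" "l dvd n" "l * l \<le> n"
proof -
  obtain c where c: "c \<ge> 0" "c dvd n" "c \<noteq> 1" "c \<noteq> n"
    using assms by (auto simp: prime_int_iff)
  then obtain d where d: "n = c * d" by blast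
  have "c > 1" using c d assms(1) by (cases "c = 0") auto
  have "d > 0" using d assms(1) \<open>c > 1\<close> by (metis less_trans zero_less_mult_pos zero_less_one)
  have "d > 1" using d c(4) \<open>d > 0\<close> by (cases "d = 1") auto
  have "\<exists>e > 1. e dvd n \<and> e * e \<le> n"
  proof (cases "c \<le> d")
    case True
    then have "c * c \<le> n" using d \<open>c > 1\<close> by simp
    then show ?thesis using c(2) \<open>c > 1\<close> by blast
  next
    case False
    then have "d * d \<le> n" using d \<open>d > 1\<close> by simp
    then show ?thesis using d \<open>d > 1\<close> by auto
  qed
  then obtain e where e: "e > 1" "e dvd n" "e * e \<le> n" by blast
  then obtain l where l: "prime l" "l dvd e" using prime_divisor_exists[of e] by auto
  have "0 \<le> l" "l \<le> e" using l e(1) prime_ge_0_int zdvd_imp_le[of l e] by auto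
  then have "l * l \<le> e * e" by (intro mult_mono) auto
  with e have "l * l \<le> n" by linarith
  then show ?thesis using that l e(2) dvd_trans by blast
qed

theorem theorem6p1:
  fixes k q :: nat and p x y m :: int and lam :: real and Q S T :: point
  assumes "k \<ge> 2"
    and "prime q"
    and "p = 2 ^ k * int q - 1"
    and "lam > 1"
    and "2 ^ k * lam \<le> sqrt (real_of_int p)"
    and "lam * sqrt (real_of_int p) > (real_of_int p powr (1 / 4) + 1)\<^sup>2"
    and "Jacobi x p = -1"
    and "Jacobi (x ^ 3 - y\<^sup>2) p = 1"
    and "m = curve_coeff p x y"
    and "Q = Affine (x mod p) (y mod p)"
    and "is_multiple p (- m) Q (2 ^ k) S"
    and "S \<noteq> Infinity"
    and "is_multiple p (- m) S q T"
  shows "(T = Infinity \<longrightarrow> prime p) \<and> (T \<noteq> Infinity \<longrightarrow> \<not> prime p)"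
proof -
  have q: "q \<ge> 2" using assms(2) prime_ge_2_nat by blast
  obtain k' where k': "k = k' + 2" using assms(1) by (metis add.commute le_Suc_ex)
  have p: "p = 4 * (2 ^ k' * int q) - 1" using assms(3) k' by (simp add: power_add)
  have "2 ^ k' * int q \<ge> 1 * 2" using q by (intro mult_mono) auto
  then have p7: "p \<ge> 7" using p by simp
  have p4: "p mod 4 = 3" using p by presburger
  have cop: "coprime x p"
    using Jacobi_nonzero[of x p] assms(7) p7 by (intro coprime_if_no_common_prime) auto
  have curve: "[y\<^sup>2 = x ^ 3 - m * x] (mod p)"
    using curve_coeff_on_curve[OF cop] assms(9) by simp
  \<comment> \<open>The second Jacobi symbol keeps \<open>x^3 - y^2\<close>, which is congruent to
    \<open>m * x\<close>, nonzero modulo each prime divisor. Thus \<open>m\<close> is nonzero there,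
    and with constant term 0 so is the discriminant.\<close>
  have ec: "elliptic_curve_mod l (- m) 0" and on_curve: "elliptic_curve_mod.on_curve l (- m) 0 x y"
    and l2: "l > 2" and m: "\<not> [m = 0] (mod l)" if l: "prime l" "l dvd p" for l
  proof -
    have "odd p" using p4 by presburger
    then have "l \<noteq> 2" using l(2) by auto
    then show l2: "l > 2" using prime_ge_2_int[OF l(1)] by simp
    have curve_l: "[y\<^sup>2 = x ^ 3 - m * x] (mod l)"
      by (rule cong_dvd_modulus[OF curve l(2)])
    have "\<not> l dvd x ^ 3 - y\<^sup>2"
      using Jacobi_nonzero[OF _ l] assms(8) p7 by simp
    moreover have "l dvd x ^ 3 - y\<^sup>2 - m * x"
      using curve_l unfolding cong_iff_dvd_diff by (metis diff_diff_eq2 diff_diff_add diff_right_commute dvd_diff_commute)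
    ultimately have lm: "\<not> l dvd m" by (metis dvd_add_right_iff dvd_mult2 diff_add_cancel)
    then show "\<not> [m = 0] (mod l)" by (simp add: cong_0_iff)
    have "\<not> l dvd 4"
    proof
      assume "l dvd 4"
      then have "l dvd 2" using prime_dvd_power_int[OF l(1), of 2 2] by simp
      then show False using l2 zdvd_imp_le[of l 2] by simp
    qed
    then have "\<not> l dvd 4 * m ^ 3" using lm l(1) by (simp add: prime_dvd_mult_iff prime_dvd_power_iff)
    then show ec: "elliptic_curve_mod l (- m) 0"
      using l l2 by unfold_locales auto
    show "elliptic_curve_mod.on_curve l (- m) 0 x y"
      unfolding elliptic_curve_mod.on_curve_def[OF ec] using curve_l by simp
  qed
  have card: "int (card (elliptic_curve_mod.points l (- m) 0)) = l + 1 + odd_prime_mod.jacobsthal l m"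
    if l: "prime l" "l dvd p" for l
  proof -
    interpret elliptic_curve_mod l "- m" 0 by (rule ec[OF l])
    show ?thesis using card_points by (simp add: jacobsthal_def)
  qed
  have "T = Infinity" if "prime p"
  proof -
    interpret elliptic_curve_mod p "- m" 0 by (rule ec[OF that dvd_refl])
    have "Q = pt x y" using assms(10) by (simp add: pt_def)
    then have Q: "Q \<in> points" using on_curve[OF that dvd_refl] by simp
    have S: "S = Q [^]\<^bsub>curve_group\<^esub> ((2::nat) ^ k)"
      by (rule is_multiple_eq_pow[OF assms(11) Q])
    then have "S \<in> points" using curve_group.nat_pow_closed Q by simp
    with S have T: "T = Q [^]\<^bsub>curve_group\<^esub> ((2::nat) ^ k * q)"
      using is_multiple_eq_pow[OF assms(13)] curve_group.nat_pow_pow Q by simp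
    \<comment> \<open>The vanishing Jacobsthal sum makes the group order \<open>p + 1\<close>, which
      is exactly the exponent \<open>2 ^ k * q\<close> in \<open>T\<close>.\<close>
    have "int (order curve_group) = p + 1"
      unfolding order_def using card[OF that dvd_refl] jacobsthal_eq_0[OF p4] by simp
    then have "int (order curve_group) = int (2 ^ k * q)" using assms(3) by simp
    then have "order curve_group = 2 ^ k * q" by (simp only: of_nat_eq_iff)
    then show ?thesis using T curve_group.pow_order_eq_1[of Q] Q by simp
  qed
  moreover have "prime p" if T: "T = Infinity"
  proof (rule ccontr)
    assume "\<not> prime p"
    then obtain l where l: "prime l" "l dvd p" "l * l \<le> p"
      using prime_divisor_le_sqrt[of p] p7 by auto
    interpret elliptic_curve_mod l "- m" 0 by (rule ec[OF l(1,2)])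
    have "S \<noteq> Undefined" using is_multiple_Undefined[of p "- m" q T] assms(13) T q by auto
    then obtain sx sy where S: "S = Affine sx sy" using assms(12) by (cases S) auto
    have "reduce Q = pt x y"
      using l(2) assms(10) by (simp add: pt_def mod_mod_cancel)
    then have Q: "reduce Q \<in> points" using on_curve[OF l(1,2)] by simp
    have "reduce S = reduce Q [^]\<^bsub>curve_group\<^esub> ((2::nat) ^ k)"
      using is_multiple_eq_pow[OF reduce_is_multiple[OF assms(11) l(2)] Q] S by simp
    then have redS: "reduce S \<in> points" using curve_group.nat_pow_closed Q by simp
    have "is_multiple l (- m) (reduce S) q Infinity"
      using reduce_is_multiple[OF assms(13) l(2)] T by simp
    from is_multiple_eq_pow[OF this redS]
    have "group.ord curve_group (reduce S) dvd q"
      using curve_group.pow_eq_id[of "reduce S" q] redS by simp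
    \<comment> \<open>\<open>S\<close> is affine and reduction sends affine points to affine points,
      so the reduced point is not neutral and its order is the prime \<open>q\<close>.\<close>
    moreover have "group.ord curve_group (reduce S) \<noteq> 1"
      using curve_group.ord_eq_1[of "reduce S"] redS S by simp
    ultimately have "group.ord curve_group (reduce S) = q"
      using assms(2) by (auto simp: prime_nat_iff)
    moreover have "int (card points) = l + 1 + jacobsthal m" by (rule card[OF l(1,2)])
    moreover have "finite points" by (simp add: finite_points)
    ultimately have "q \<le> card points"
      using curve_group.ord_le_group_order[of "reduce S"] redS by (simp add: order_def)
    then have q_le: "real q \<le> l + 1 + jacobsthal m"
      using card[OF l(1,2)] by linarith
    have l0: "real_of_int l \<ge> 0" using l2[OF l(1,2)] by simp
    have "real_of_int ((jacobsthal m)\<^sup>2) \<le> real_of_int (4 * l)"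
      using jacobsthal_bound[OF m[OF l(1,2)]] by (simp only: of_int_le_iff)
    moreover have "(2 * sqrt l)\<^sup>2 = real_of_int (4 * l)"
      using l0 by (simp add: power_mult_distrib)
    ultimately have "(real_of_int (jacobsthal m))\<^sup>2 \<le> (2 * sqrt l)\<^sup>2"
      by (simp only: of_int_power)
    then have "real_of_int (jacobsthal m) \<le> 2 * sqrt l"
      by (rule power2_le_imp_le) (use l0 in simp)
    then have "real q \<le> (sqrt l + 1)\<^sup>2"
      using q_le l0 by (simp add: power2_sum)
    also have "\<dots> \<le> (p powr (1 / 4) + 1)\<^sup>2"
    proof (intro power_mono add_mono order_refl)
      have "real_of_int l * l \<le> p" using l(3) by (metis of_int_le_iff of_int_mult)
      then have "(real_of_int l)\<^sup>2 \<le> p" by (simp add: power2_eq_square)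
      then have "l \<le> sqrt p" using real_le_rsqrt by blast
      then have "sqrt l \<le> sqrt (sqrt p)" by simp
      also have "\<dots> = p powr (1 / 4)"
        using p7 by (simp add: powr_powr flip: powr_half_sqrt)
      finally show "sqrt l \<le> p powr (1 / 4)" .
    qed (use l0 in simp)
    also have "\<dots> < lam * sqrt p" by (rule assms(6))
    \<comment> \<open>Multiplying by \<open>2 ^ k\<close> leads to \<open>2 ^ k * q < p\<close>,
      although \<open>2 ^ k * q\<close> equals \<open>p + 1\<close>.\<close>
    finally have "2 ^ k * real q < 2 ^ k * (lam * sqrt p)" by simp
    also have "\<dots> = (2 ^ k * lam) * sqrt p" by simp
    also have "\<dots> \<le> sqrt p * sqrt p" using assms(5) p7 by (intro mult_right_mono) auto
    also have "\<dots> = p" using p7 by simp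
    also have "\<dots> < 2 ^ k * real q" unfolding assms(3) by simp
    finally show False .
  qed
  ultimately show ?thesis by blast
qed

end
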